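(* Let $g\ge 0$, $0\le k\le g$ and $0\le r\le g-k$ be integers. Then the subquotient of the Lefschetz filtration $$\mathrm{gr}_r\,\Lambda^{k+2r}(\mathbb Z^{2g}) = F_r\Lambda^{k+2r}(\mathbb Z^{2g})/F_{r-1}\Lambda^{k+2r}(\mathbb Z^{2g})$$ is a free abelian group, and it is isomorphic as an $\mathrm{Sp}(2g)$-module to $P^k(\mathbb Z^{2g})$.
   Context: $\mathbb Z^{2g}$ has standard basis $e^1,\dots,e^{2g}$ and carries the standard symplectic form; its symplectic element is $\omega = e^1\wedge e^2+\cdots+e^{2g-1}\wedge e^{2g}\in\Lambda^2(\mathbb Z^{2g})$. $\mathrm{Sp}(2g)=\mathrm{Sp}(2g,\mathbb Z)$ acts on $\Lambda^*(\mathbb Z^{2g})$ and fixes $\omega$. The Lefschetz filtration is $$F_r\Lambda^m(\mathbb Z^{2g})=\{\alpha\in\Lambda^m(\mathbb Z^{2g}) \mid \omega^{g-m+r+1}\wedge\alpha=0\}$$ (whenever the exponent is $\ge 0$, with $\omega^0=1$). For $0\le k\le g$ the primitive subspace is $P^k(\mathbb Z^{2g})=F_0\Lambda^k(\mathbb Z^{2g})=\{x\in\Lambda^k(\mathbb Z^{2g})\mid \omega^{g-k+1}\wedge x=0\}$. All these are $\mathrm{Sp}(2g)$-submodules. *)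

theory Defs
  imports "HOL-Algebra.Free_Abelian_Groups" "HOL-Algebra.Bij" "Jordan_Normal_Form.Matrix"
begin

section \<open>The exterior algebra of a free abelian group with ordered basis\<close>

text \<open>
  The exterior algebra of the free abelian group on \<open>e_0, e_1, e_2, \<dots>\<close> is free on the monomials
  \<open>e_I = e_{i_1} \<and> \<dots> \<and> e_{i_m}\<close> for finite sets \<open>I = {i_1 < \<dots> < i_m}\<close>. It is modelled by finitely
  supported integral combinations of such \<open>I\<close>, with \<open>frag_of I\<close> in the role of \<open>e_I\<close>.
  Indices start at \<open>0\<close>, as they do for vectors and matrices.
\<close>

type_synonym ext = "nat set \<Rightarrow>\<^sub>0 int"

definition ext_power :: "nat \<Rightarrow> nat \<Rightarrow> ext monoid" where
  "ext_power n m = free_Abelian_group {I. I \<subseteq> {..<n} \<and> card I = m}"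

text \<open>For disjoint \<open>I\<close> and \<open>J\<close>, sorting \<open>e_I \<and> e_J\<close> takes one transposition for each inversion.\<close>

definition wedge_monom :: "nat set \<Rightarrow> nat set \<Rightarrow> ext" where
  "wedge_monom I J =
     (if I \<inter> J = {}
      then frag_cmul ((-1) ^ card {(i, j). i \<in> I \<and> j \<in> J \<and> j < i}) (frag_of (I \<union> J))
      else 0)"

definition wedge :: "ext \<Rightarrow> ext \<Rightarrow> ext" (infixr "\<and>\<and>" 70) where
  "x \<and>\<and> y = frag_extend (\<lambda>I. frag_extend (\<lambda>J. wedge_monom I J) y) x"

definition ext_one :: ext where
  "ext_one = frag_of {}"

definition wedge_power :: "ext \<Rightarrow> nat \<Rightarrow> ext" where
  "wedge_power x k = ((\<lambda>y. x \<and>\<and> y) ^^ k) ext_one"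

definition ext_vec :: "int vec \<Rightarrow> ext" where
  "ext_vec v = (\<Sum>i<dim_vec v. frag_cmul (v $ i) (frag_of {i}))"

text \<open>The induced action: \<open>e_{i_1} \<and> \<dots> \<and> e_{i_m} \<mapsto> A e_{i_1} \<and> \<dots> \<and> A e_{i_m}\<close>, extended linearly.\<close>

definition ext_map :: "int mat \<Rightarrow> ext \<Rightarrow> ext" where
  "ext_map A =
     frag_extend (\<lambda>I. foldr (\<lambda>i y. ext_vec (col A i) \<and>\<and> y) (sorted_list_of_set I) ext_one)"


section \<open>The integral symplectic group\<close>

definition symp_form :: "nat \<Rightarrow> int mat" where
  "symp_form g = mat (2 * g) (2 * g)
     (\<lambda>(i, j). if even i \<and> j = Suc i then 1 else if even j \<and> i = Suc j then -1 else 0)"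

definition Sp :: "nat \<Rightarrow> int mat monoid" where
  "Sp g = \<lparr>carrier = {A \<in> carrier_mat (2 * g) (2 * g). A\<^sup>T * symp_form g * A = symp_form g},
           monoid.mult = (*), one = 1\<^sub>m (2 * g)\<rparr>"

definition symp_elt :: "nat \<Rightarrow> ext" where
  "symp_elt g = (\<Sum>i<g. frag_of {2 * i} \<and>\<and> frag_of {2 * i + 1})"


section \<open>The Lefschetz filtration\<close>

text \<open>The filtration step is an integer, since the step \<open>-1\<close> occurs. A negative exponent, for which
  the filtration is left undefined in the mathematics, is truncated to \<open>0\<close> here.\<close>

definition lefschetz :: "nat \<Rightarrow> int \<Rightarrow> nat \<Rightarrow> ext set" where
  "lefschetz g r m =
     {\<alpha> \<in> carrier (ext_power (2 * g) m).
        wedge_power (symp_elt g) (nat (int g - int m + r + 1)) \<and>\<and> \<alpha> = 0}"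

definition lefschetz_group :: "nat \<Rightarrow> int \<Rightarrow> nat \<Rightarrow> ext monoid" where
  "lefschetz_group g r m = (ext_power (2 * g) m)\<lparr>carrier := lefschetz g r m\<rparr>"

definition primitive_group :: "nat \<Rightarrow> nat \<Rightarrow> ext monoid" where
  "primitive_group g k = lefschetz_group g 0 k"

definition lefschetz_gr :: "nat \<Rightarrow> int \<Rightarrow> nat \<Rightarrow> ext set monoid" where
  "lefschetz_gr g r m = lefschetz_group g r m Mod lefschetz g (r - 1) m"


section \<open>Free abelian groups and modules over a group\<close>

text \<open>Taking the index set of the basis in the type of the group elements loses no generality:
  the basis itself can serve as index set.\<close>

definition is_free_abelian :: "'a monoid \<Rightarrow> bool" where
  "is_free_abelian M \<longleftrightarrow> (\<exists>S :: 'a set. M \<cong> free_Abelian_group S)"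

definition group_module :: "'g monoid \<Rightarrow> 'a monoid \<Rightarrow> ('g \<Rightarrow> 'a \<Rightarrow> 'a) \<Rightarrow> bool" where
  "group_module G M \<rho> \<longleftrightarrow>
     group G \<and> comm_group M \<and> (\<lambda>a. restrict (\<rho> a) (carrier M)) \<in> hom G (AutoGroup M)"

definition module_isomorphic ::
  "'g monoid \<Rightarrow> 'a monoid \<Rightarrow> ('g \<Rightarrow> 'a \<Rightarrow> 'a) \<Rightarrow> 'b monoid \<Rightarrow> ('g \<Rightarrow> 'b \<Rightarrow> 'b) \<Rightarrow> bool" where
  "module_isomorphic G M \<rho> N \<sigma> \<longleftrightarrow>
     group_module G M \<rho> \<and> group_module G N \<sigma> \<and>
     (\<exists>h \<in> iso M N. \<forall>a \<in> carrier G. \<forall>x \<in> carrier M. h (\<rho> a x) = \<sigma> a (h x))"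

end

(*
  Write \<omega>^[j] = \<omega>^j / j! (an integral element) and d = g - k. Both gr_r \<Lambda>^(k+2r) and P^k embed
  Sp(2g)-equivariantly into K = ker(\<omega> : \<Lambda>^(2g-k) \<rightarrow> \<Lambda>^(2g-k+2)): the first by \<omega>^[d-r], whose kernel on
  F_r is F_(r-1), the second by \<omega>^[d], which is injective on \<Lambda>^k. Both images are all of K, because
  any y of degree m with \<omega> y = 0 is divisible by \<omega>^[j] over the integers as long as g + j \<le> m.
  That divisibility and the injectivity are proved by induction on g, expanding
  x = x0 + e x1 + f x2 + (e f) x3 along the last hyperbolic pair e, f. The subquotient is free since P^k
  is a subgroup of a free abelian group of finite rank.
*)

theory Submission
  imports Defs "Jordan_Normal_Form.Determinant"
begin

text \<open>Multiplication by \<omega>^r, the obvious map from P^k to gr_r, is an isomorphism only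
  rationally. Even \<omega>^[r] fails over the integers: followed by the embedding \<omega>^[d-r] of
  gr_r into K it is binom(d,r) \<omega>^[d], so its image has index a power of binom(d,r). The
  isomorphism is therefore one embedding into K composed with the inverse of the other, and the
  burden moves to integral surjectivity onto K, which ordinary powers, being j! times divided ones,
  cannot provide. Absence of torsion is used throughout: \<omega>^j and \<omega>^[j] have the same
  kernel, so the filtration can be described by divided powers, and an identity may be proved after
  multiplication by a nonzero integer.\<close>

section \<open>The exterior algebra as a graded ring\<close>

text \<open>The type also contains monomials with infinite index sets, where an infinite set of
  inversions has \<open>card\<close> 0 and the sign is meaningless. The algebraic laws that depend
  on signs are proved on the span of the finite monomials.\<close>

definition ext_finite :: "ext \<Rightarrow> bool" where
  "ext_finite x \<longleftrightarrow> Poly_Mapping.keys x \<subseteq> Collect finite"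

lemma ext_finite_simps [simp]:
  "ext_finite 0" "ext_finite (frag_of I) \<longleftrightarrow> finite I" "ext_finite (- x) \<longleftrightarrow> ext_finite x"
  "ext_finite ext_one"
  by (auto simp: ext_finite_def ext_one_def)

lemma ext_finite_add [simp]: "ext_finite x \<Longrightarrow> ext_finite y \<Longrightarrow> ext_finite (x + y)"
  and ext_finite_diff [simp]: "ext_finite x \<Longrightarrow> ext_finite y \<Longrightarrow> ext_finite (x - y)"
  and ext_finite_cmul [simp]: "ext_finite x \<Longrightarrow> ext_finite (frag_cmul c x)"
  using keys_add[of x y] keys_diff[of x y] keys_cmul[of c x] unfolding ext_finite_def
  by (metis order_trans Un_least)+

lemma ext_finite_sum [simp]: "(\<And>i. i \<in> S \<Longrightarrow> ext_finite (f i)) \<Longrightarrow> ext_finite (sum f S)"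
  by (induction S rule: infinite_finite_induct) auto

text \<open>Monomials generate under subtraction, so an additive identity needs checking only on
  them. Most laws below are proved in this way, one variable at a time.\<close>

lemma ext_finite_induct [consumes 1, case_names zero one diff]:
  assumes "ext_finite x" "P 0" "\<And>I. finite I \<Longrightarrow> P (frag_of I)"
    "\<And>a b. P a \<Longrightarrow> P b \<Longrightarrow> P (a - b)"
  shows "P x"
  using frag_induction[of x "Collect finite" P] assms by (auto simp: ext_finite_def)

lemma wedge_frag_of [simp]: "frag_of I \<and>\<and> frag_of J = wedge_monom I J"
  by (simp add: wedge_def)

lemma frag_extend_fun_diff:
  fixes f g :: "'a \<Rightarrow> 'b \<Rightarrow>\<^sub>0 int"
  shows
  "frag_extend (\<lambda>i. f i - g i) x = frag_extend f x - frag_extend g x"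
proof -
  have "frag_cmul c (a - b) = frag_cmul c a - frag_cmul c b" for c and a b :: "'b \<Rightarrow>\<^sub>0 int"
    by (rule poly_mapping_eqI) (simp add: lookup_minus right_diff_distrib)
  then show ?thesis by (simp add: frag_extend_def sum_subtractf)
qed

lemma frag_extend_fun_zero [simp]: "frag_extend (\<lambda>i. 0) x = 0"
  by (simp add: frag_extend_def)

lemma wedge_zero_left [simp]: "0 \<and>\<and> y = 0"
  and wedge_zero_right [simp]: "x \<and>\<and> 0 = 0"
  and wedge_diff_left: "(x - x') \<and>\<and> y = x \<and>\<and> y - x' \<and>\<and> y"
  and wedge_diff_right: "x \<and>\<and> (y - y') = x \<and>\<and> y - x \<and>\<and> y'"
  by (simp_all add: wedge_def frag_extend_diff frag_extend_fun_diff)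

lemma wedge_minus_left: "(- x) \<and>\<and> y = - (x \<and>\<and> y)"
  and wedge_minus_right: "x \<and>\<and> (- y) = - (x \<and>\<and> y)"
  using wedge_diff_left[of 0 x y] wedge_diff_right[of x 0 y] by auto

lemma wedge_add_left: "(x + x') \<and>\<and> y = x \<and>\<and> y + x' \<and>\<and> y"
  and wedge_add_right: "x \<and>\<and> (y + y') = x \<and>\<and> y + x \<and>\<and> y'"
  using wedge_diff_left[of x "- x'" y] wedge_diff_right[of x y "- y'"]
  by (auto simp: wedge_minus_left wedge_minus_right)

text \<open>An additive map of abelian groups is automatically linear over the integers.\<close>

lemma frag_cmul_additive:
  fixes f :: "('a \<Rightarrow>\<^sub>0 int) \<Rightarrow> ('b \<Rightarrow>\<^sub>0 int)"
  assumes "f 0 = 0" "\<And>x y. f (x - y) = f x - f y"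
  shows "f (frag_cmul c x) = frag_cmul c (f x)"
proof -
  have minus: "f (- x) = - f x" for x using assms(2)[of 0 x] assms(1) by simp
  have add: "f (x + y) = f x + f y" for x y using assms(2)[of x "- y"] minus by simp
  have nat: "f (frag_cmul (int n) x) = frag_cmul (int n) (f x)" for n
    by (induction n) (use assms(1) in \<open>simp_all add: frag_cmul_distrib add\<close>)
  show ?thesis
  proof (cases c rule: int_cases2)
    case (nonpos n)
    then show ?thesis using nat[of n] minus[of "frag_cmul (int n) x"] by simp
  qed (use nat in simp)
qed

lemma wedge_cmul_left: "frag_cmul c x \<and>\<and> y = frag_cmul c (x \<and>\<and> y)"
  and wedge_cmul_right: "x \<and>\<and> frag_cmul c y = frag_cmul c (x \<and>\<and> y)"
  using frag_cmul_additive[of "\<lambda>x. x \<and>\<and> y" c x] frag_cmul_additive[of "\<lambda>y. x \<and>\<and> y" c y]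
  by (auto simp: wedge_diff_left wedge_diff_right)

lemma wedge_sum_left: "sum f S \<and>\<and> y = (\<Sum>i\<in>S. f i \<and>\<and> y)"
  and wedge_sum_right: "x \<and>\<and> sum f S = (\<Sum>i\<in>S. x \<and>\<and> f i)"
  by (induction S rule: infinite_finite_induct) (auto simp: wedge_add_left wedge_add_right)

lemma ext_finite_wedge_monom [simp]: "finite I \<Longrightarrow> finite J \<Longrightarrow> ext_finite (wedge_monom I J)"
  by (simp add: wedge_monom_def)

lemma ext_finite_wedge [simp]: "ext_finite x \<Longrightarrow> ext_finite y \<Longrightarrow> ext_finite (x \<and>\<and> y)"
proof (induction x rule: ext_finite_induct)
  case (one I)
  from one(2,1) show ?case
    by (induction y rule: ext_finite_induct) (auto simp: wedge_diff_right)
qed (auto simp: wedge_diff_left)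

section \<open>Signs, associativity and graded commutativity\<close>

definition inversions :: "nat set \<Rightarrow> nat set \<Rightarrow> nat" where
  "inversions I J = card {(i, j). i \<in> I \<and> j \<in> J \<and> j < i}"

lemma finite_inversions: "finite I \<Longrightarrow> finite J \<Longrightarrow> finite {(i, j). i \<in> I \<and> j \<in> J \<and> j < (i::nat)}"
  by (rule finite_subset[of _ "I \<times> J"]) auto

lemma inversions_Un_left:
  assumes "finite I" "finite J" "finite K" "I \<inter> J = {}"
  shows "inversions (I \<union> J) K = inversions I K + inversions J K"
  unfolding inversions_def
  by (subst card_Un_disjoint[symmetric]) (use assms in \<open>auto simp: finite_inversions intro!: arg_cong[where f=card]\<close>)

lemma inversions_Un_right:
  assumes "finite I" "finite J" "finite K" "J \<inter> K = {}"
  shows "inversions I (J \<union> K) = inversions I J + inversions I K"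
  unfolding inversions_def
  by (subst card_Un_disjoint[symmetric]) (use assms in \<open>auto simp: finite_inversions intro!: arg_cong[where f=card]\<close>)

text \<open>Disjointness excludes ties, so every pair in \<open>I \<times> J\<close> is an inversion
  in exactly one of the two orders.\<close>

lemma inversions_swap:
  assumes "finite I" "finite J" "I \<inter> J = {}"
  shows "inversions I J + inversions J I = card I * card J"
proof -
  have "inversions J I = card (prod.swap ` {(j, i). j \<in> J \<and> i \<in> I \<and> i < j})"
    unfolding inversions_def by (rule card_image[symmetric]) (auto simp: inj_on_def)
  also have "prod.swap ` {(j, i). j \<in> J \<and> i \<in> I \<and> i < j} = {(i, j). i \<in> I \<and> j \<in> J \<and> i < j}"
    by force
  also have "inversions I J + card \<dots> = card ({(i, j). i \<in> I \<and> j \<in> J \<and> j < i} \<union> {(i, j). i \<in> I \<and> j \<in> J \<and> i < j})"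
  proof -
    have fin: "finite {(i, j). i \<in> I \<and> j \<in> J \<and> i < j}"
      by (rule finite_subset[of _ "I \<times> J"]) (use assms in auto)
    show ?thesis
      unfolding inversions_def
      by (rule card_Un_disjoint[OF finite_inversions[OF assms(1,2)] fin, symmetric]) auto
  qed
  also have "{(i, j). i \<in> I \<and> j \<in> J \<and> j < i} \<union> {(i, j). i \<in> I \<and> j \<in> J \<and> i < j} = I \<times> J"
    using assms(3) by (auto simp: disjoint_iff) (metis nat_neq_iff)
  finally show ?thesis by (simp add: card_cartesian_product)
qed

lemma wedge_monom_eq:
  "wedge_monom I J = (if I \<inter> J = {} then frag_cmul ((-1) ^ inversions I J) (frag_of (I \<union> J)) else 0)"
  by (simp add: wedge_monom_def inversions_def)

text \<open>On pairwise disjoint monomials both sides carry the sign exponent inv(I,J) + inv(I,K) +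
  inv(J,K), because inversions are additive in each argument; otherwise both sides vanish.\<close>

lemma wedge_assoc:
  assumes "ext_finite x" "ext_finite y" "ext_finite z"
  shows "(x \<and>\<and> y) \<and>\<and> z = x \<and>\<and> (y \<and>\<and> z)"
  using assms(1)
proof (induction x rule: ext_finite_induct)
  case I: (one I)
  show ?case using assms(2)
  proof (induction y rule: ext_finite_induct)
    case J: (one J)
    show ?case using assms(3)
    proof (induction z rule: ext_finite_induct)
      case K: (one K)
      show ?case
        using I J K
        by (auto simp: wedge_monom_eq wedge_cmul_left wedge_cmul_right inversions_Un_left
            inversions_Un_right Int_Un_distrib Int_Un_distrib2 Un_assoc ac_simps simp flip: power_add)
    qed (auto simp: wedge_diff_left wedge_diff_right)
  qed (auto simp: wedge_diff_left wedge_diff_right)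
qed (auto simp: wedge_diff_left wedge_diff_right)

lemma wedge_one_left [simp]: "ext_one \<and>\<and> x = x"
  and wedge_one_right [simp]: "x \<and>\<and> ext_one = x"
proof -
  have *: "inversions {} I = 0" "inversions I {} = 0" for I by (auto simp: inversions_def)
  have "Poly_Mapping.keys x \<subseteq> UNIV" by simp
  then have "ext_one \<and>\<and> x = x \<and> x \<and>\<and> ext_one = x"
    by (induction x rule: frag_induction)
      (auto simp: ext_one_def wedge_monom_eq wedge_diff_left wedge_diff_right *)
  then show "ext_one \<and>\<and> x = x" "x \<and>\<and> ext_one = x" by auto
qed

lemma wedge_monom_swap:
  assumes "finite I" "finite J"
  shows "wedge_monom I J = frag_cmul ((-1) ^ (card I * card J)) (wedge_monom J I)"
  using assms
  by (auto simp: wedge_monom_eq Int_commute Un_commute power_add mult.assoc simp flip: inversions_swap)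

text \<open>Such elements commute with everything finite. This is what lets \<omega>, its divided
  powers and e f move freely through products.\<close>

definition ext_even :: "ext \<Rightarrow> bool" where
  "ext_even x \<longleftrightarrow> Poly_Mapping.keys x \<subseteq> {I. finite I \<and> even (card I)}"

lemma wedge_even_commute:
  assumes "ext_even x" "ext_finite y"
  shows "x \<and>\<and> y = y \<and>\<and> x"
  using assms(1)[unfolded ext_even_def]
proof (induction x rule: frag_induction)
  case (one I)
  show ?case using assms(2)
    by (induction y rule: ext_finite_induct)
      (use one in \<open>auto simp: wedge_diff_left wedge_diff_right wedge_monom_swap[of I]\<close>)
qed (auto simp: wedge_diff_left wedge_diff_right)

lemma ext_even_finite: "ext_even x \<Longrightarrow> ext_finite x"
  by (auto simp: ext_even_def ext_finite_def)

lemma wedge_even_left_commute: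
  assumes "ext_even x" "ext_finite y" "ext_finite z"
  shows "x \<and>\<and> (y \<and>\<and> z) = y \<and>\<and> (x \<and>\<and> z)"
  using assms ext_even_finite[OF assms(1)] wedge_even_commute[OF assms(1,2)]
  by (metis wedge_assoc)

text \<open>The degree is an integer so that degree shifts such as \<open>d - 2\<close> are not truncated.\<close>

definition ext_part :: "nat \<Rightarrow> int \<Rightarrow> ext set" where
  "ext_part n d = {x. Poly_Mapping.keys x \<subseteq> {I. I \<subseteq> {..<n} \<and> int (card I) = d}}"

lemma ext_part_finite: "x \<in> ext_part n d \<Longrightarrow> ext_finite x"
  unfolding ext_part_def ext_finite_def
  by (auto elim!: order_trans intro: finite_subset[OF _ finite_lessThan])

lemma ext_part_induct [consumes 1, case_names zero one diff]:
  assumes "x \<in> ext_part n d" "P 0" "\<And>I. I \<subseteq> {..<n} \<Longrightarrow> int (card I) = d \<Longrightarrow> P (frag_of I)"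
    "\<And>a b. P a \<Longrightarrow> P b \<Longrightarrow> P (a - b)"
  shows "P x"
  using frag_induction[of x "{I. I \<subseteq> {..<n} \<and> int (card I) = d}" P] assms
  by (auto simp: ext_part_def)

lemma zero_in_ext_part [simp]: "0 \<in> ext_part n d"
  and frag_of_in_ext_part: "I \<subseteq> {..<n} \<Longrightarrow> d = int (card I) \<Longrightarrow> frag_of I \<in> ext_part n d"
  by (auto simp: ext_part_def)

lemma ext_part_add: "x \<in> ext_part n d \<Longrightarrow> y \<in> ext_part n d \<Longrightarrow> x + y \<in> ext_part n d"
  and ext_part_diff: "x \<in> ext_part n d \<Longrightarrow> y \<in> ext_part n d \<Longrightarrow> x - y \<in> ext_part n d"
  and ext_part_minus: "x \<in> ext_part n d \<Longrightarrow> - x \<in> ext_part n d"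
  and ext_part_cmul: "x \<in> ext_part n d \<Longrightarrow> frag_cmul c x \<in> ext_part n d"
  unfolding ext_part_def using keys_add[of x y] keys_diff[of x y] keys_cmul[of c x] by (simp_all, blast+)

lemma ext_part_sum: "(\<And>i. i \<in> S \<Longrightarrow> f i \<in> ext_part n d) \<Longrightarrow> sum f S \<in> ext_part n d"
  by (induction S rule: infinite_finite_induct) (auto intro: ext_part_add)

lemma ext_part_mono: "x \<in> ext_part n d \<Longrightarrow> n \<le> n' \<Longrightarrow> x \<in> ext_part n' d"
  unfolding ext_part_def by (auto elim!: order_trans)

lemma wedge_in_ext_part:
  assumes "x \<in> ext_part n a" "y \<in> ext_part n b" "d = a + b"
  shows "x \<and>\<and> y \<in> ext_part n d"
  using assms(1)
proof (induction x rule: ext_part_induct)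
  case I: (one I)
  then have "finite I" using finite_subset by blast
  show ?case using assms(2)
  proof (induction y rule: ext_part_induct)
    case (one J)
    then have "finite J" using finite_subset by blast
    then show ?case using I one \<open>finite I\<close> \<open>d = _\<close>
      by (auto simp: wedge_monom_eq card_Un_disjoint intro!: ext_part_cmul frag_of_in_ext_part)
  qed (auto simp: wedge_diff_right intro: ext_part_diff)
qed (auto simp: wedge_diff_left intro: ext_part_diff)

lemma ext_even_part: "x \<in> ext_part n (2 * d) \<Longrightarrow> ext_even x"
proof -
  have "even k" if "int k = 2 * d" for k using that by presburger
  then show "x \<in> ext_part n (2 * d) \<Longrightarrow> ext_even x"
    unfolding ext_part_def ext_even_def
    by (auto elim!: order_trans intro: finite_subset[OF _ finite_lessThan])
qed

lemma ext_one_in_ext_part: "ext_one \<in> ext_part n 0"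
  by (simp add: ext_one_def frag_of_in_ext_part)

lemma carrier_ext_power: "carrier (ext_power n m) = ext_part n (int m)"
  by (auto simp: ext_power_def ext_part_def free_Abelian_group_def)

section \<open>Divided powers of the symplectic element\<close>

lemma inversions_singleton_left: "inversions {n} J = card {j \<in> J. j < n}"
proof -
  have "{(i, j). i \<in> {n} \<and> j \<in> J \<and> j < i} = Pair n ` {j \<in> J. j < n}" by auto
  then show ?thesis by (simp add: inversions_def card_image inj_on_def)
qed

lemma inversions_top_left: "J \<subseteq> {..<n} \<Longrightarrow> inversions {n} J = card J"
  unfolding inversions_singleton_left by (rule arg_cong[where f = card]) auto

text \<open>Interior multiplication by the covector dual to \<open>e_n\<close>, for \<open>n\<close> the largest index.\<close>

definition contract_top :: "nat \<Rightarrow> ext \<Rightarrow> ext" where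
  "contract_top n = frag_extend
     (\<lambda>I. if n \<in> I then frag_cmul ((-1) ^ card (I - {n})) (frag_of (I - {n})) else 0)"

lemma contract_top_add: "contract_top n (x + y) = contract_top n x + contract_top n y"
  by (simp add: contract_top_def frag_extend_add)

lemma contract_top_part: "x \<in> ext_part n d \<Longrightarrow> contract_top n x = 0"
  by (induction x rule: ext_part_induct) (auto simp: contract_top_def frag_extend_diff)

text \<open>Moving e_n past a monomial in lower indices produces the very sign built into the
  contraction, and the two cancel. Thus contraction is a left inverse of multiplication by
  e_n.\<close>

lemma contract_top_wedge:
  assumes "x \<in> ext_part n d"
  shows "contract_top n (frag_of {n} \<and>\<and> x) = x"
  using assms
proof (induction x rule: ext_part_induct)
  case (one I)
  then have "n \<notin> I" by auto
  with one show ?case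
    by (simp add: wedge_monom_eq inversions_top_left contract_top_def frag_extend_cmul
        flip: power_add mult_2)
qed (auto simp: contract_top_def wedge_diff_right frag_extend_diff)

lemma ext_part_Suc_split:
  assumes "x \<in> ext_part (Suc n) d"
  shows "\<exists>a\<in>ext_part n d. \<exists>b\<in>ext_part n (d - 1). x = a + frag_of {n} \<and>\<and> b"
  using assms
proof (induction x rule: ext_part_induct)
  case zero
  show ?case by (intro bexI[of _ 0]) auto
next
  case (one I)
  show ?case
  proof (cases "n \<in> I")
    case False
    with one have "frag_of I \<in> ext_part n d"
      by (intro frag_of_in_ext_part) (auto simp: lessThan_Suc)
    then show ?thesis by (intro bexI[of _ "frag_of I"] bexI[of _ 0]) auto
  next
    case True
    let ?J = "I - {n}"
    have J: "?J \<subseteq> {..<n}" using one by (auto simp: lessThan_Suc)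
    have "finite I" using one finite_subset by blast
    then have card: "int (card ?J) = d - 1" using card_Suc_Diff1[OF \<open>finite I\<close> True] one(2) by linarith
    \<comment> \<open>The coefficient undoes the sign of pulling e_n to the front.\<close>
    have "frag_of I = frag_of {n} \<and>\<and> frag_cmul ((-1) ^ card ?J) (frag_of ?J)"
      using True J
      by (simp add: wedge_cmul_right wedge_monom_eq inversions_top_left insert_absorb flip: power_add mult_2)
    moreover have "frag_cmul ((-1) ^ card ?J) (frag_of ?J) \<in> ext_part n (d - 1)"
      using J card by (intro ext_part_cmul frag_of_in_ext_part) auto
    ultimately show ?thesis by (intro bexI[of _ 0] bexI) auto
  qed
next
  case (diff x y)
  then obtain a b a' b' where "a \<in> ext_part n d" "b \<in> ext_part n (d - 1)" "x = a + frag_of {n} \<and>\<and> b"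
    "a' \<in> ext_part n d" "b' \<in> ext_part n (d - 1)" "y = a' + frag_of {n} \<and>\<and> b'" by blast
  then show ?case
    by (intro bexI[of _ "a - a'"] bexI[of _ "b - b'"]) (auto simp: wedge_diff_right ext_part_diff)
qed

text \<open>Uniqueness of the splitting: contraction kills \<open>a\<close> and returns
  \<open>b\<close>.\<close>

lemma ext_part_Suc_eq_0:
  assumes "a \<in> ext_part n d" "b \<in> ext_part n d'" "a + frag_of {n} \<and>\<and> b = 0"
  shows "a = 0 \<and> b = 0"
proof -
  have "contract_top n (a + frag_of {n} \<and>\<and> b) = b"
    using assms(1,2) by (simp add: contract_top_add contract_top_part contract_top_wedge)
  then have "b = 0" using assms(3) by (simp add: contract_top_def)
  then show ?thesis using assms(3) by simp
qed

section \<open>Expansion along the last hyperbolic pair e, f\<close>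

definition pair_elt :: "nat \<Rightarrow> ext" where
  "pair_elt g = frag_of {2 * g, Suc (2 * g)}"

definition glue :: "nat \<Rightarrow> ext \<Rightarrow> ext \<Rightarrow> ext \<Rightarrow> ext \<Rightarrow> ext" where
  "glue g x0 x1 x2 x3 =
     x0 + frag_of {2 * g} \<and>\<and> x1 + frag_of {Suc (2 * g)} \<and>\<and> x2 + pair_elt g \<and>\<and> x3"

lemma inversions_singletons: "inversions {i} {j} = (if j < i then 1 else 0)"
  by (auto simp: inversions_singleton_left conj_commute cong: conj_cong)

lemma frag_of_wedge_pair: "frag_of {2 * g} \<and>\<and> frag_of {Suc (2 * g)} = pair_elt g"
  and frag_of_wedge_pair_swap: "frag_of {Suc (2 * g)} \<and>\<and> frag_of {2 * g} = - pair_elt g"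
  by (auto simp: pair_elt_def wedge_monom_eq inversions_singletons insert_commute)

lemma pair_elt_finite [simp]: "ext_finite (pair_elt g)"
  by (simp add: pair_elt_def)

lemma pair_elt_even: "ext_even (pair_elt g)"
  by (simp add: pair_elt_def ext_even_def)

lemma pair_elt_in_ext_part: "pair_elt g \<in> ext_part (2 * Suc g) 2"
  unfolding pair_elt_def by (intro frag_of_in_ext_part) auto

lemma glue_in_ext_part:
  assumes "x0 \<in> ext_part (2 * g) d" "x1 \<in> ext_part (2 * g) (d - 1)"
    "x2 \<in> ext_part (2 * g) (d - 1)" "x3 \<in> ext_part (2 * g) (d - 2)"
  shows "glue g x0 x1 x2 x3 \<in> ext_part (2 * Suc g) d"
proof -
  have *: "2 * g \<le> 2 * Suc g" by simp
  show ?thesis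
    unfolding glue_def
    by (intro ext_part_add wedge_in_ext_part[OF pair_elt_in_ext_part, where b = "d - 2"]
        wedge_in_ext_part[where a = 1 and b = "d - 1"] frag_of_in_ext_part assms[THEN ext_part_mono, OF *]) auto
qed

text \<open>Split off the top index f, then split off e from both parts.\<close>

lemma ext_part_glue:
  assumes "x \<in> ext_part (2 * Suc g) d"
  obtains x0 x1 x2 x3 where "x = glue g x0 x1 x2 x3"
    "x0 \<in> ext_part (2 * g) d" "x1 \<in> ext_part (2 * g) (d - 1)"
    "x2 \<in> ext_part (2 * g) (d - 1)" "x3 \<in> ext_part (2 * g) (d - 2)"
proof -
  obtain a b where ab: "a \<in> ext_part (Suc (2 * g)) d" "b \<in> ext_part (Suc (2 * g)) (d - 1)"
    "x = a + frag_of {Suc (2 * g)} \<and>\<and> b"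
    using ext_part_Suc_split[of x "Suc (2 * g)" d] assms by auto
  obtain a0 a1 where a: "a0 \<in> ext_part (2 * g) d" "a1 \<in> ext_part (2 * g) (d - 1)"
    "a = a0 + frag_of {2 * g} \<and>\<and> a1"
    using ext_part_Suc_split[OF ab(1)] by auto
  obtain b0 b1 where b: "b0 \<in> ext_part (2 * g) (d - 1)" "b1 \<in> ext_part (2 * g) (d - 2)"
    "b = b0 + frag_of {2 * g} \<and>\<and> b1"
    using ext_part_Suc_split[OF ab(2)] by auto
  \<comment> \<open>Since f e = - e f, the last component is \<open>- b1\<close>.\<close>
  have "frag_of {Suc (2 * g)} \<and>\<and> (frag_of {2 * g} \<and>\<and> b1) = pair_elt g \<and>\<and> (- b1)"
    using ext_part_finite[OF b(2)] frag_of_wedge_pair_swap[of g]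
    by (subst wedge_assoc[symmetric]) (auto simp: wedge_minus_left wedge_minus_right simp del: wedge_frag_of)
  then have "x = glue g a0 a1 b0 (- b1)"
    by (simp add: ab(3) a(3) b(3) glue_def wedge_add_right)
  then show ?thesis using that a(1,2) b(1,2) ext_part_minus by blast
qed

lemma glue_eq_0:
  assumes "x0 \<in> ext_part (2 * g) d" "x1 \<in> ext_part (2 * g) (d - 1)"
    "x2 \<in> ext_part (2 * g) (d - 1)" "x3 \<in> ext_part (2 * g) (d - 2)"
    "glue g x0 x1 x2 x3 = 0"
  shows "x0 = 0" "x1 = 0" "x2 = 0" "x3 = 0"
proof -
  \<comment> \<open>Regrouping by the top index f: the term (e f) x3 equals f (e (- x3)), so it
    joins x2 in the coefficient of f.\<close>
  let ?a = "x0 + frag_of {2 * g} \<and>\<and> x1" and ?b = "x2 + frag_of {2 * g} \<and>\<and> (- x3)"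
  have "frag_of {Suc (2 * g)} \<and>\<and> (frag_of {2 * g} \<and>\<and> (- x3)) = pair_elt g \<and>\<and> x3"
    using ext_part_finite[OF assms(4)] frag_of_wedge_pair_swap[of g]
    by (subst wedge_assoc[symmetric]) (auto simp: wedge_minus_left wedge_minus_right simp del: wedge_frag_of)
  then have 0: "?a + frag_of {Suc (2 * g)} \<and>\<and> ?b = 0"
    using assms(5) by (simp add: glue_def wedge_add_right add.assoc)
  have e: "frag_of {2 * g} \<in> ext_part (Suc (2 * g)) 1" by (intro frag_of_in_ext_part) auto
  have mono: "x \<in> ext_part (2 * g) c \<Longrightarrow> x \<in> ext_part (Suc (2 * g)) c" for x c
    by (erule ext_part_mono) simp
  have a: "?a \<in> ext_part (Suc (2 * g)) d"
    by (rule ext_part_add[OF mono[OF assms(1)] wedge_in_ext_part[OF e mono[OF assms(2)]]]) simp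
  have b: "?b \<in> ext_part (Suc (2 * g)) (d - 1)"
    by (rule ext_part_add[OF mono[OF assms(3)] wedge_in_ext_part[OF e mono[OF ext_part_minus[OF assms(4)]]]]) simp
  have "?a = 0" "?b = 0" using ext_part_Suc_eq_0[OF a b 0] by auto
  then have "x0 = 0 \<and> x1 = 0" "x2 = 0 \<and> - x3 = 0"
    using ext_part_Suc_eq_0[OF assms(1,2)] ext_part_Suc_eq_0[OF assms(3) ext_part_minus[OF assms(4)]]
    by auto
  then show "x0 = 0" "x1 = 0" "x2 = 0" "x3 = 0" by auto
qed

lemma pair_elt_wedge_self:
  assumes "ext_finite x" "2 * g \<in> I \<or> Suc (2 * g) \<in> I" "finite I"
  shows "pair_elt g \<and>\<and> (frag_of I \<and>\<and> x) = 0"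
  using assms by (subst wedge_assoc[symmetric]) (auto simp: pair_elt_def wedge_monom_eq)

text \<open>The term (e f) c' survives only against \<open>x0\<close>: every other component already
  contains e or f. Hence multiplication acts componentwise apart from one extra term in the last
  slot, and this coupling is the whole difficulty of the inductions on the genus.\<close>

lemma wedge_glue:
  assumes c: "ext_even c" "ext_even c'"
    and x: "ext_finite x0" "ext_finite x1" "ext_finite x2" "ext_finite x3"
  shows "(c + pair_elt g \<and>\<and> c') \<and>\<and> glue g x0 x1 x2 x3 =
    glue g (c \<and>\<and> x0) (c \<and>\<and> x1) (c \<and>\<and> x2) (c \<and>\<and> x3 + c' \<and>\<and> x0)"
proof -
  note [simp] = c[THEN ext_even_finite] x
  have *: "pair_elt g \<and>\<and> (c' \<and>\<and> (frag_of I \<and>\<and> x)) = 0"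
    if "ext_finite x" "2 * g \<in> I \<or> Suc (2 * g) \<in> I" "finite I" for I x
    using that by (simp add: wedge_even_left_commute[OF c(2)] pair_elt_wedge_self)
  have "pair_elt g \<and>\<and> (c' \<and>\<and> (pair_elt g \<and>\<and> x3)) = 0"
    using *[of x3 "{2 * g, Suc (2 * g)}"] by (simp add: pair_elt_def)
  note [simp] = this
  have "(c + pair_elt g \<and>\<and> c') \<and>\<and> glue g x0 x1 x2 x3 =
     c \<and>\<and> glue g x0 x1 x2 x3 + pair_elt g \<and>\<and> (c' \<and>\<and> glue g x0 x1 x2 x3)"
    by (simp add: wedge_add_left wedge_assoc glue_def)
  also have "pair_elt g \<and>\<and> (c' \<and>\<and> glue g x0 x1 x2 x3) = pair_elt g \<and>\<and> (c' \<and>\<and> x0)"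
    by (simp add: glue_def wedge_add_right *)
  also have "c \<and>\<and> glue g x0 x1 x2 x3 = glue g (c \<and>\<and> x0) (c \<and>\<and> x1) (c \<and>\<and> x2) (c \<and>\<and> x3)"
    by (simp add: glue_def wedge_add_right wedge_even_left_commute[OF c(1)])
  finally show ?thesis by (simp add: glue_def wedge_add_right)
qed

text \<open>The divided powers \<open>\<omega>^j / j!\<close>.\<close>

fun symp_div :: "nat \<Rightarrow> nat \<Rightarrow> ext" where
  "symp_div g 0 = ext_one"
| "symp_div 0 (Suc j) = 0"
| "symp_div (Suc g) (Suc j) = symp_div g (Suc j) + pair_elt g \<and>\<and> symp_div g j"

lemma symp_div_in_ext_part: "symp_div g j \<in> ext_part (2 * g) (2 * int j)"
proof (induction g j rule: symp_div.induct)
  case (3 g j)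
  have *: "2 * g \<le> 2 * Suc g" by simp
  show ?case
    unfolding symp_div.simps
    by (intro ext_part_add wedge_in_ext_part[OF pair_elt_in_ext_part, where b = "2 * int j"] 3[THEN ext_part_mono, OF *]) simp
qed (auto intro: ext_one_in_ext_part)

lemma symp_div_even: "ext_even (symp_div g j)"
  by (rule ext_even_part[OF symp_div_in_ext_part])

lemma symp_div_finite [simp]: "ext_finite (symp_div g j)"
  by (rule ext_even_finite[OF symp_div_even])

lemma symp_elt_eq: "symp_elt g = symp_div g 1"
proof (induction g)
  case (Suc g)
  then show ?case
    using frag_of_wedge_pair[of g] by (simp add: symp_elt_def del: wedge_frag_of)
qed (simp add: symp_elt_def)

lemma symp_elt_finite [simp]: "ext_finite (symp_elt g)"
  by (simp add: symp_elt_eq)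

lemma symp_elt_Suc: "symp_elt (Suc g) = symp_elt g + pair_elt g \<and>\<and> ext_one"
  by (simp add: symp_elt_eq)

lemma frag_cmul_2: "frag_cmul 2 x = x + x"
  using frag_cmul_distrib[of 1 1 x] by simp

text \<open>\<open>symp_div g j\<close> is the j-th elementary symmetric polynomial in the
  commuting, square-zero elements \<open>pair_elt i\<close> with i < g. Multiplying by their sum
  reaches each product of j + 1 of them in j + 1 ways.\<close>

lemma symp_elt_wedge_symp_div:
  "symp_elt g \<and>\<and> symp_div g j = frag_cmul (int j + 1) (symp_div g (Suc j))"
proof (induction g arbitrary: j)
  case 0
  then show ?case by (simp add: symp_elt_def)
next
  case (Suc g)
  show ?case
  proof (cases j)
    case (Suc i)
    let ?p = "pair_elt g" and ?w = "symp_elt g" and ?D = "symp_div g"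
    have pp: "?p \<and>\<and> (?p \<and>\<and> ?D i) = 0"
      using pair_elt_wedge_self[of "?D i" g "{2 * g, Suc (2 * g)}"] by (simp add: pair_elt_def)
    have wp: "?w \<and>\<and> (?p \<and>\<and> ?D i) = ?p \<and>\<and> (?w \<and>\<and> ?D i)"
      by (simp add: wedge_even_left_commute[OF pair_elt_even])
    \<comment> \<open>With p = e f, p p = 0 and j = i + 1, the p-part is p \<omega>^[j] + p \<omega>
      \<omega>^[i], and the hypothesis turns its second term into (i + 1) p \<omega>^[j], for a
      total of j + 1.\<close>
    show ?thesis
      by (simp add: Suc symp_elt_Suc wedge_add_left wedge_add_right pp wp Suc.IH wedge_cmul_right
          frag_cmul_distrib frag_cmul_distrib2 frag_cmul_2)
  qed (simp add: symp_elt_eq)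
qed

lemma symp_elt_wedge_symp_div_wedge:
  assumes "ext_finite x"
  shows "symp_elt g \<and>\<and> (symp_div g j \<and>\<and> x) = frag_cmul (int j + 1) (symp_div g (Suc j) \<and>\<and> x)"
  using assms by (simp add: symp_elt_wedge_symp_div wedge_cmul_left flip: wedge_assoc)

lemma wedge_power_symp_elt: "wedge_power (symp_elt g) j = frag_cmul (fact j) (symp_div g j)"
proof (induction j)
  case (Suc j)
  then show ?case
    by (simp add: wedge_power_def wedge_cmul_right symp_elt_wedge_symp_div algebra_simps)
qed (simp add: wedge_power_def)

section \<open>Injectivity and divisibility by induction on the genus\<close>

lemma ext_part_0: "x \<in> ext_part 0 d \<Longrightarrow> d \<noteq> 0 \<Longrightarrow> x = 0"
proof -
  assume x: "x \<in> ext_part 0 d" "d \<noteq> 0"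
  have empty: "{I. I \<subseteq> {..<0::nat} \<and> int (card I) = d} = {}" using x(2) by auto
  show ?thesis using x(1) unfolding ext_part_def empty by simp
qed

lemma symp_div_wedge_in_ext_part:
  assumes "x \<in> ext_part (2 * g) d" "d' = d + 2 * int j"
  shows "symp_div g j \<and>\<and> x \<in> ext_part (2 * g) d'"
  by (rule wedge_in_ext_part[OF symp_div_in_ext_part assms(1)]) (simp add: assms(2))

lemma symp_div_Suc_wedge_glue:
  assumes "x0 \<in> ext_part (2 * g) d" "x1 \<in> ext_part (2 * g) (d - 1)"
    "x2 \<in> ext_part (2 * g) (d - 1)" "x3 \<in> ext_part (2 * g) (d - 2)"
  shows "symp_div (Suc g) (Suc j) \<and>\<and> glue g x0 x1 x2 x3 =
    glue g (symp_div g (Suc j) \<and>\<and> x0) (symp_div g (Suc j) \<and>\<and> x1) (symp_div g (Suc j) \<and>\<and> x2)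
      (symp_div g (Suc j) \<and>\<and> x3 + symp_div g j \<and>\<and> x0)"
  unfolding symp_div.simps using assms[THEN ext_part_finite]
  by (intro wedge_glue symp_div_even)

text \<open>The balance between degree and exponent is kept in genus one less: the components have
  degrees k, k - 1, k - 1, k - 2, and the induction hypothesis is applied with exponents j - 1, j,
  j, j + 1.\<close>

lemma symp_div_wedge_inj:
  assumes "z \<in> ext_part (2 * g) k" "k + int j = int g" "symp_div g j \<and>\<and> z = 0"
  shows "z = 0"
  using assms
proof (induction g arbitrary: z k j)
  case 0
  then show ?case by (cases j) (auto dest: ext_part_0)
next
  case (Suc g)
  show ?case
  proof (cases j)
    case 0
    then show ?thesis using Suc.prems by simp
  next
    case (Suc i)
    obtain z0 z1 z2 z3 where z: "z = glue g z0 z1 z2 z3"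
      "z0 \<in> ext_part (2 * g) k" "z1 \<in> ext_part (2 * g) (k - 1)"
      "z2 \<in> ext_part (2 * g) (k - 1)" "z3 \<in> ext_part (2 * g) (k - 2)"
      using ext_part_glue[OF Suc.prems(1)] .
    note fin [simp] = z(2-5)[THEN ext_part_finite]
    let ?D = "symp_div g"
    have glue0: "glue g (?D j \<and>\<and> z0) (?D j \<and>\<and> z1) (?D j \<and>\<and> z2) (?D j \<and>\<and> z3 + ?D i \<and>\<and> z0) = 0"
      using Suc.prems(3) unfolding z(1) Suc symp_div_Suc_wedge_glue[OF z(2-5)] .
    have eqs: "?D j \<and>\<and> z0 = 0" "?D j \<and>\<and> z1 = 0" "?D j \<and>\<and> z2 = 0" "?D j \<and>\<and> z3 + ?D i \<and>\<and> z0 = 0"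
      by (rule glue_eq_0[OF _ _ _ _ glue0, where d = "k + 2 * int j"];
          intro ext_part_add symp_div_wedge_in_ext_part[OF z(2)] symp_div_wedge_in_ext_part[OF z(3)]
            symp_div_wedge_in_ext_part[OF z(4)] symp_div_wedge_in_ext_part[OF z(5)]; simp add: Suc)+
    have "z1 = 0" "z2 = 0"
      using Suc.IH[OF z(3) _ eqs(2)] Suc.IH[OF z(4) _ eqs(3)] Suc.prems(2) by auto
    \<comment> \<open>Multiplying by \<omega> decouples the last equation: it turns
      \<open>?D i \<and>\<and> z0\<close> into a multiple of \<open>?D j \<and>\<and> z0\<close>,
      which vanishes, and \<open>?D j \<and>\<and> z3\<close> into a nonzero multiple of
      \<open>?D (Suc j) \<and>\<and> z3\<close>.\<close>
    have "symp_elt g \<and>\<and> (?D j \<and>\<and> z3 + ?D i \<and>\<and> z0) = 0" by (simp add: eqs)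
    then have "?D (Suc j) \<and>\<and> z3 = 0"
      using eqs(1) by (simp add: wedge_add_right symp_elt_wedge_symp_div_wedge Suc)
    then have "z3 = 0" using Suc.IH[OF z(5), of "Suc j"] Suc.prems(2) by auto
    then have "z0 = 0" using eqs(4) Suc.IH[OF z(2), of i] Suc.prems(2) Suc by auto
    show ?thesis using z(1) \<open>z0 = 0\<close> \<open>z1 = 0\<close> \<open>z2 = 0\<close> \<open>z3 = 0\<close> by (simp add: glue_def)
  qed
qed

text \<open>In components the hypothesis says that \<omega> kills y0, y1, y2 and sends y3 to - y0.
  Relative to the bound in genus one less, y0 has degree to spare and y1, y2 have just enough. The
  component y3 need not be killed by \<omega>, so it must be corrected before the induction
  hypothesis can apply.\<close>

lemma symp_elt_kernel_divisible:
  assumes "y \<in> ext_part (2 * g) m" "symp_elt g \<and>\<and> y = 0" "int g + int j \<le> m"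
  shows "\<exists>x\<in>ext_part (2 * g) (m - 2 * int j). symp_div g j \<and>\<and> x = y"
  using assms
proof (induction g arbitrary: y m j)
  case 0
  show ?case
  proof (cases "m = 0")
    case True
    then show ?thesis using 0 by auto
  next
    case False
    then have "y = 0" using 0(1) ext_part_0 by auto
    then show ?thesis by (intro bexI[of _ 0]) auto
  qed
next
  case (Suc g)
  show ?case
  proof (cases j)
    case 0
    then show ?thesis using Suc.prems by auto
  next
    case (Suc i)
    obtain y0 y1 y2 y3 where y: "y = glue g y0 y1 y2 y3"
      "y0 \<in> ext_part (2 * g) m" "y1 \<in> ext_part (2 * g) (m - 1)"
      "y2 \<in> ext_part (2 * g) (m - 1)" "y3 \<in> ext_part (2 * g) (m - 2)"
      using ext_part_glue[OF Suc.prems(1)] .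
    let ?w = "symp_elt g" and ?D = "symp_div g"
    have glue0: "glue g (?D (Suc 0) \<and>\<and> y0) (?D (Suc 0) \<and>\<and> y1) (?D (Suc 0) \<and>\<and> y2)
        (?D (Suc 0) \<and>\<and> y3 + ?D 0 \<and>\<and> y0) = 0"
      using Suc.prems(2) unfolding y(1) symp_elt_eq One_nat_def symp_div_Suc_wedge_glue[OF y(2-5)] .
    have "?D (Suc 0) \<and>\<and> y0 = 0" "?D (Suc 0) \<and>\<and> y1 = 0" "?D (Suc 0) \<and>\<and> y2 = 0"
      "?D (Suc 0) \<and>\<and> y3 + ?D 0 \<and>\<and> y0 = 0"
      by (rule glue_eq_0[OF _ _ _ _ glue0, where d = "m + 2"];
          intro ext_part_add symp_div_wedge_in_ext_part[OF y(2)] symp_div_wedge_in_ext_part[OF y(3)]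
            symp_div_wedge_in_ext_part[OF y(4)] symp_div_wedge_in_ext_part[OF y(5)]; simp)+
    then have eqs: "?w \<and>\<and> y0 = 0" "?w \<and>\<and> y1 = 0" "?w \<and>\<and> y2 = 0" "?w \<and>\<and> y3 = - y0"
      by (simp_all add: symp_elt_eq eq_neg_iff_add_eq_0)
    obtain x1 where x1: "x1 \<in> ext_part (2 * g) (m - 1 - 2 * int j)" "?D j \<and>\<and> x1 = y1"
      using Suc.IH[OF y(3) eqs(2), of j] Suc.prems(3) by auto
    obtain x2 where x2: "x2 \<in> ext_part (2 * g) (m - 1 - 2 * int j)" "?D j \<and>\<and> x2 = y2"
      using Suc.IH[OF y(4) eqs(3), of j] Suc.prems(3) by auto
    obtain x0 where x0: "x0 \<in> ext_part (2 * g) (m - 2 * int j)" "?D j \<and>\<and> x0 = y0"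
      using Suc.IH[OF y(2) eqs(1), of j] Suc.prems(3) by auto
    \<comment> \<open>The spare degree of y0 allows division by one higher divided power as well; u
      serves to cancel \<omega> y3.\<close>
    obtain u where u: "u \<in> ext_part (2 * g) (m - 2 * int j - 2)" "?D (Suc j) \<and>\<and> u = y0"
      using Suc.IH[OF y(2) eqs(1), of "Suc j"] Suc.prems(3) by (auto simp: algebra_simps)
    note [simp] = x0(1)[THEN ext_part_finite] u(1)[THEN ext_part_finite]
    \<comment> \<open>Under \<open>\<omega>\<close> the three terms of \<open>w\<close> become \<open>-1\<close>, \<open>-(i + 1)\<close> and \<open>i + 2\<close> times \<open>y0\<close>, so \<open>\<omega>\<close> kills \<open>w\<close> and
      the induction hypothesis applies to it.\<close>
    define w where "w = y3 - ?D i \<and>\<and> x0 + ?D j \<and>\<and> u"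
    have w: "w \<in> ext_part (2 * g) (m - 2)"
      unfolding w_def
      by (intro ext_part_add ext_part_diff y symp_div_wedge_in_ext_part[OF x0(1)]
          symp_div_wedge_in_ext_part[OF u(1)]) (simp_all add: Suc)
    have ww: "?w \<and>\<and> w = 0"
    proof -
      have "?w \<and>\<and> (?D i \<and>\<and> x0) = frag_cmul (int i + 1) y0"
        using x0(2) by (simp add: symp_elt_wedge_symp_div_wedge Suc)
      moreover have "?w \<and>\<and> (?D j \<and>\<and> u) = frag_cmul (int i + 1) y0 + y0"
        using u(2) by (simp add: symp_elt_wedge_symp_div_wedge Suc frag_cmul_distrib frag_cmul_2)
      ultimately show ?thesis
        by (simp add: w_def wedge_add_right wedge_diff_right eqs)
    qed
    \<comment> \<open>The equations for y0 and y3 share x0, so a lift of y0 cannot be fixed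
      independently of y3. Dividing w by \<omega>^[j] corrects x3 alone; if its degree is too low
      for that, the correction goes into x0.\<close>
    obtain x0' x3 where x': "x0' \<in> ext_part (2 * g) (m - 2 * int j)" "?D j \<and>\<and> x0' = y0"
      "x3 \<in> ext_part (2 * g) (m - 2 * int j - 2)" "?D j \<and>\<and> x3 + ?D i \<and>\<and> x0' = y3"
    proof (cases "int g + int j \<le> m - 2")
      case True
      obtain v where v: "v \<in> ext_part (2 * g) (m - 2 - 2 * int j)" "?D j \<and>\<and> v = w"
        using Suc.IH[OF w ww True] by auto
      show ?thesis
      proof (rule that[of x0 "v - u"])
        show "v - u \<in> ext_part (2 * g) (m - 2 * int j - 2)"
          using ext_part_diff[of v _ "m - 2 * int j - 2"] v(1) u(1) by (simp add: algebra_simps)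
      qed (use x0 v(2) in \<open>simp_all add: wedge_diff_right w_def\<close>)
    next
      \<comment> \<open>Here m = g + j + 1, so w has degree g + i, which is exactly enough for
        division by \<omega>^[i]. The quotient v has the degree of x0.\<close>
      case False
      then obtain v where v: "v \<in> ext_part (2 * g) (m - 2 - 2 * int i)" "?D i \<and>\<and> v = w"
        using Suc.IH[OF w ww, of i] Suc.prems(3) Suc by auto
      \<comment> \<open>Because \<omega> w = 0, cancelling i + 1 shows that \<omega>^[j] kills v, so
        \<open>x0 + v\<close> still lifts y0.\<close>
      have "frag_cmul (int i + 1) (?D j \<and>\<and> v) = 0"
        using ww v(2) symp_elt_wedge_symp_div_wedge[OF ext_part_finite[OF v(1)], of g i] by (simp add: Suc)
      then have Dv: "?D j \<and>\<and> v = 0" by auto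
      show ?thesis
      proof (rule that[of "x0 + v" "- u"])
        show "x0 + v \<in> ext_part (2 * g) (m - 2 * int j)"
          using ext_part_add[OF x0(1), of v] v(1) Suc by (simp add: algebra_simps)
      qed (use x0 v(2) u Dv in \<open>simp_all add: wedge_add_right wedge_minus_right w_def ext_part_minus\<close>)
    qed
    have mem: "x1 \<in> ext_part (2 * g) (m - 2 * int j - 1)" "x2 \<in> ext_part (2 * g) (m - 2 * int j - 1)"
      using x1(1) x2(1) by (simp_all add: algebra_simps)
    show ?thesis
    proof (intro bexI)
      show "glue g x0' x1 x2 x3 \<in> ext_part (2 * Suc g) (m - 2 * int j)"
        by (rule glue_in_ext_part[OF x'(1) mem x'(3)])
      show "symp_div (Suc g) j \<and>\<and> glue g x0' x1 x2 x3 = y"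
        using symp_div_Suc_wedge_glue[OF x'(1) mem x'(3), of i] x1(2) x2(2) x'(2,4) by (simp add: Suc y(1))
    qed
  qed
qed

section \<open>Functoriality and the symplectic group\<close>

lemma wedge_anticommute:
  assumes "x \<in> ext_part n 1" "y \<in> ext_part n 1"
  shows "x \<and>\<and> y = - (y \<and>\<and> x)"
  using assms(1)
proof (induction x rule: ext_part_induct)
  case I: (one I)
  then have "finite I" using finite_subset by blast
  show ?case using assms(2)
  proof (induction y rule: ext_part_induct)
    case (one J)
    then have "finite J" using finite_subset by blast
    then show ?case using I one \<open>finite I\<close> by (simp add: wedge_monom_swap[of I])
  qed (auto simp: wedge_diff_left wedge_diff_right)
qed (auto simp: wedge_diff_left wedge_diff_right)

text \<open>Anticommutation gives only that twice the square vanishes; absence of torsion does the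
  rest.\<close>

lemma wedge_self:
  assumes "x \<in> ext_part n 1"
  shows "x \<and>\<and> x = 0"
proof -
  have "x \<and>\<and> x + x \<and>\<and> x = 0"
    using wedge_anticommute[OF assms assms] by (simp add: eq_neg_iff_add_eq_0)
  then have "frag_cmul 2 (x \<and>\<and> x) = 0" unfolding frag_cmul_2 .
  then show ?thesis by simp
qed

lemma ext_vec_in_ext_part: "ext_vec v \<in> ext_part (dim_vec v) 1"
  unfolding ext_vec_def by (intro ext_part_sum ext_part_cmul frag_of_in_ext_part) auto

lemma ext_vec_finite [simp]: "ext_finite (ext_vec v)"
  by (rule ext_part_finite[OF ext_vec_in_ext_part])

lemma ext_vec_wedge_self:
  assumes "ext_finite x"
  shows "ext_vec v \<and>\<and> (ext_vec v \<and>\<and> x) = 0"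
  using assms wedge_self[OF ext_vec_in_ext_part] by (simp flip: wedge_assoc)

lemma ext_vec_wedge_swap:
  assumes "dim_vec v = dim_vec w" "ext_finite x"
  shows "ext_vec v \<and>\<and> (ext_vec w \<and>\<and> x) = - (ext_vec w \<and>\<and> (ext_vec v \<and>\<and> x))"
proof -
  have "ext_vec v \<and>\<and> ext_vec w = - (ext_vec w \<and>\<and> ext_vec v)"
    using wedge_anticommute ext_vec_in_ext_part assms(1) by metis
  then show ?thesis using assms by (simp add: wedge_minus_left flip: wedge_assoc)
qed

lemma ext_map_zero [simp]: "ext_map A 0 = 0"
  and ext_map_diff: "ext_map A (x - y) = ext_map A x - ext_map A y"
  and ext_map_add: "ext_map A (x + y) = ext_map A x + ext_map A y"
  and ext_map_minus: "ext_map A (- x) = - ext_map A x"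
  and ext_map_cmul: "ext_map A (frag_cmul c x) = frag_cmul c (ext_map A x)"
  by (simp_all add: ext_map_def frag_extend_diff frag_extend_add frag_extend_minus frag_extend_cmul)

lemma ext_map_sum: "ext_map A (sum f S) = (\<Sum>i\<in>S. ext_map A (f i))"
  by (induction S rule: infinite_finite_induct) (auto simp: ext_map_add)

lemma ext_map_empty [simp]: "ext_map A (frag_of {}) = ext_one"
  by (simp add: ext_map_def)

lemma ext_map_one [simp]: "ext_map A ext_one = ext_one"
  by (simp add: ext_one_def)

text \<open>A new minimum becomes the head of the sorted list, so the \<open>foldr\<close> unrolls
  by one step. For this reason the inductions on index sets below always add a minimum.\<close>

lemma ext_map_insert_min:
  assumes "finite J" "\<And>j. j \<in> J \<Longrightarrow> m < j"
  shows "ext_map A (frag_of (insert m J)) = ext_vec (col A m) \<and>\<and> ext_map A (frag_of J)"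
proof -
  have "m \<notin> J" using assms(2) by blast
  then have "sorted_list_of_set (insert m J) = insort m (sorted_list_of_set J)"
    using assms(1) by (simp add: sorted_list_of_set_insert_remove)
  also have "\<dots> = m # sorted_list_of_set J"
    using assms by (intro insort_is_Cons) (auto intro: less_imp_le)
  finally show ?thesis by (simp add: ext_map_def)
qed

lemma ext_map_frag_of_in_ext_part:
  "finite I \<Longrightarrow> ext_map A (frag_of I) \<in> ext_part (dim_row A) (int (card I))"
proof (induction I rule: finite_linorder_min_induct)
  case (insert m I)
  moreover have "m \<notin> I" using insert by blast
  ultimately show ?case
    using wedge_in_ext_part[OF ext_vec_in_ext_part[of "col A m"], of "ext_map A (frag_of I)"]
    by (simp add: ext_map_insert_min)
qed (simp add: ext_one_in_ext_part)

lemma ext_map_in_ext_part: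
  assumes "x \<in> ext_part n d"
  shows "ext_map A x \<in> ext_part (dim_row A) d"
  using assms
proof (induction x rule: ext_part_induct)
  case (one I)
  then have "finite I" using finite_subset by blast
  then show ?case using ext_map_frag_of_in_ext_part one by metis
qed (auto simp: ext_map_diff ext_part_diff)

lemma ext_map_finite [simp]: "ext_finite x \<Longrightarrow> ext_finite (ext_map A x)"
proof (induction x rule: ext_finite_induct)
  case (one I)
  then show ?case using ext_part_finite[OF ext_map_frag_of_in_ext_part] by blast
qed (auto simp: ext_map_diff)

lemma frag_of_insert_min:
  assumes "\<And>j. j \<in> J \<Longrightarrow> m < j"
  shows "frag_of {m} \<and>\<and> frag_of J = frag_of (insert m J)"
proof -
  have empty: "{j \<in> J. j < m} = {}" and "m \<notin> J" using assms by (auto dest: less_asym)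
  then show ?thesis
    unfolding wedge_frag_of wedge_monom_eq inversions_singleton_left empty by simp
qed

lemma frag_of_wedge_swap:
  assumes "i \<noteq> m" "ext_finite x"
  shows "frag_of {i} \<and>\<and> (frag_of {m} \<and>\<and> x) = - (frag_of {m} \<and>\<and> (frag_of {i} \<and>\<and> x))"
proof -
  have "frag_of {i} \<and>\<and> frag_of {m} = - (frag_of {m} \<and>\<and> frag_of {i})"
    by (simp add: wedge_monom_swap[of "{i}"])
  then show ?thesis using assms(2) by (simp add: wedge_minus_left del: wedge_frag_of flip: wedge_assoc)
qed

text \<open>Compare i with the minimum m of the index set. Below it the definition unrolls; if
  equal, both sides contain a repeated vector and vanish; above it, e_i and e_m are swapped in the
  source and their images in the target, with the same sign.\<close>

lemma ext_map_singleton_wedge_frag_of: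
  assumes "finite J"
  shows "ext_map A (frag_of {i} \<and>\<and> frag_of J) = ext_vec (col A i) \<and>\<and> ext_map A (frag_of J)"
  using assms
proof (induction J rule: finite_linorder_min_induct)
  case empty
  show ?case
    using ext_map_insert_min[of "{}" i A] wedge_one_right[of "frag_of {i}"]
    by (simp add: ext_one_def del: wedge_one_right)
next
  case (insert m J)
  consider "i < m" | "i = m" | "m < i" by linarith
  then show ?case
  proof cases
    case 1
    then have min: "\<And>j. j \<in> insert m J \<Longrightarrow> i < j" using insert by (auto dest: less_trans)
    have fin: "finite (insert m J)" using insert(1) by simp
    show ?thesis
      by (subst frag_of_insert_min, erule min) (rule ext_map_insert_min[OF fin], erule min)
  next
    case 2
    then show ?thesis
      using insert by (simp add: wedge_monom_eq ext_map_insert_min ext_vec_wedge_self)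
  next
    case 3
    have min: "\<And>j. j \<in> insert i J \<Longrightarrow> m < j" using insert 3 by auto
    have "frag_of {m} \<and>\<and> frag_of (insert i J) = frag_of (insert m (insert i J))"
      using min by (rule frag_of_insert_min)
    moreover have "ext_map A (frag_of (insert m (insert i J))) =
        ext_vec (col A m) \<and>\<and> ext_map A (frag_of (insert i J))"
      using insert(1) by (intro ext_map_insert_min min) auto
    \<comment> \<open>The product of e_i and e_J is zero or, up to sign, the monomial of
      \<open>insert i J\<close>, all of whose indices exceed m.\<close>
    ultimately have swap: "ext_map A (frag_of {m} \<and>\<and> wedge_monom {i} J) = ext_vec (col A m) \<and>\<and> ext_map A (wedge_monom {i} J)"
      by (auto simp: wedge_monom_eq[of "{i}"] wedge_cmul_right ext_map_cmul simp del: wedge_frag_of)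
    have "frag_of {i} \<and>\<and> frag_of (insert m J) = frag_of {i} \<and>\<and> (frag_of {m} \<and>\<and> frag_of J)"
      using insert(2) by (subst frag_of_insert_min) auto
    also have "\<dots> = - (frag_of {m} \<and>\<and> (frag_of {i} \<and>\<and> frag_of J))"
      using insert(1) 3 by (intro frag_of_wedge_swap) auto
    finally have "ext_map A (frag_of {i} \<and>\<and> frag_of (insert m J)) =
        - (ext_vec (col A m) \<and>\<and> (ext_vec (col A i) \<and>\<and> ext_map A (frag_of J)))"
      using swap insert.IH by (simp add: ext_map_minus)
    also have "\<dots> = ext_vec (col A i) \<and>\<and> (ext_vec (col A m) \<and>\<and> ext_map A (frag_of J))"
      using insert(1) by (subst ext_vec_wedge_swap) auto
    finally show ?thesis using insert by (simp add: ext_map_insert_min)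
  qed
qed

lemma ext_map_singleton_wedge:
  assumes "ext_finite y"
  shows "ext_map A (frag_of {i} \<and>\<and> y) = ext_vec (col A i) \<and>\<and> ext_map A y"
  using assms
  by (induction y rule: ext_finite_induct)
    (auto simp: ext_map_singleton_wedge_frag_of wedge_diff_right ext_map_diff simp del: wedge_frag_of)

text \<open>Peel the factors of a monomial off one at a time, smallest index first.\<close>

lemma ext_map_wedge:
  assumes "ext_finite x" "ext_finite y"
  shows "ext_map A (x \<and>\<and> y) = ext_map A x \<and>\<and> ext_map A y"
  using assms(1)
proof (induction x rule: ext_finite_induct)
  case (one I)
  then show ?case
  proof (induction I rule: finite_linorder_min_induct)
    case empty
    show ?case by (simp flip: ext_one_def)
  next
    case (insert m I)
    then have "frag_of (insert m I) = frag_of {m} \<and>\<and> frag_of I"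
      by (subst frag_of_insert_min) auto
    then show ?case
      using insert assms(2)
      by (simp add: wedge_assoc ext_map_singleton_wedge del: wedge_frag_of)
  qed
qed (auto simp: wedge_diff_left ext_map_diff)

lemma ext_vec_mult_mat_vec:
  assumes "P \<in> carrier_mat m n" "w \<in> carrier_vec n"
  shows "ext_vec (P *\<^sub>v w) = (\<Sum>b<n. frag_cmul (w $ b) (ext_vec (col P b)))"
proof -
  have "(\<Sum>b<n. frag_cmul (w $ b) (ext_vec (col P b))) =
      (\<Sum>b<n. \<Sum>i<m. frag_cmul (w $ b * P $$ (i, b)) (frag_of {i}))"
    using assms by (simp add: ext_vec_def frag_cmul_sum)
  also have "\<dots> = (\<Sum>i<m. \<Sum>b<n. frag_cmul (w $ b * P $$ (i, b)) (frag_of {i}))"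
    by (rule sum.swap)
  also have "\<dots> = (\<Sum>i<m. frag_cmul (\<Sum>b<n. w $ b * P $$ (i, b)) (frag_of {i}))"
  proof -
    have "frag_cmul (sum f S) x = (\<Sum>b\<in>S. frag_cmul (f b) x)" for f and S :: "nat set" and x :: ext
      by (induction S rule: infinite_finite_induct) (auto simp: frag_cmul_distrib)
    then show ?thesis by simp
  qed
  also have "\<dots> = ext_vec (P *\<^sub>v w)"
    using assms by (simp add: ext_vec_def scalar_prod_def lessThan_atLeast0 mult.commute)
  finally show ?thesis by simp
qed

lemma ext_map_ext_vec:
  assumes "A \<in> carrier_mat m n" "w \<in> carrier_vec n"
  shows "ext_map A (ext_vec w) = ext_vec (A *\<^sub>v w)"
proof -
  have "ext_map A (frag_of {i}) = ext_vec (col A i)" for i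
    using ext_map_insert_min[of "{}" i A] by simp
  then show ?thesis
    using assms by (simp add: ext_vec_mult_mat_vec ext_vec_def[of w] ext_map_sum ext_map_cmul)
qed

lemma ext_map_mult:
  assumes "A \<in> carrier_mat n n" "B \<in> carrier_mat n n" "x \<in> ext_part n d"
  shows "ext_map (A * B) x = ext_map A (ext_map B x)"
  using assms(3)
proof (induction x rule: ext_part_induct)
  case (one I)
  then have "finite I" using finite_subset by blast
  then show ?case using one(1)
  proof (induction I rule: finite_linorder_min_induct)
    case (insert m I)
    then have "ext_vec (col (A * B) m) = ext_map A (ext_vec (col B m))"
      using assms(1,2) by (subst ext_map_ext_vec[OF assms(1)]) (auto simp: col_mult2)
    then show ?case using insert by (simp add: ext_map_insert_min ext_map_wedge)
  qed simp
qed (auto simp: ext_map_diff)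

lemma ext_vec_unit_vec:
  assumes "i < n"
  shows "ext_vec (unit_vec n i) = frag_of {i}"
proof -
  have "ext_vec (unit_vec n i) = (\<Sum>j<n. if j = i then frag_of {i} else 0)"
    unfolding ext_vec_def using assms by (intro sum.cong) (auto simp: unit_vec_def)
  then show ?thesis using assms by simp
qed

lemma ext_map_one_mat:
  assumes "x \<in> ext_part n d"
  shows "ext_map (1\<^sub>m n) x = x"
  using assms
proof (induction x rule: ext_part_induct)
  case (one I)
  then have "finite I" using finite_subset by blast
  then show ?case using one(1)
  proof (induction I rule: finite_linorder_min_induct)
    case (insert m I)
    then show ?case
      by (simp add: ext_map_insert_min ext_vec_unit_vec frag_of_insert_min del: wedge_frag_of)
  qed (simp add: ext_one_def)
qed (auto simp: ext_map_diff)

text \<open>One-sided inverses of square matrices over a field are two-sided; the identity is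
  obtained over the rationals and pulled back along the injection of the integers.\<close>

lemma mat_left_inverse_imp_right_inverse:
  fixes A B :: "int mat"
  assumes A: "A \<in> carrier_mat n n" and B: "B \<in> carrier_mat n n" and BA: "B * A = 1\<^sub>m n"
  shows "A * B = 1\<^sub>m n"
proof -
  let ?r = "map_mat rat_of_int"
  have "?r B * ?r A = 1\<^sub>m n"
    using BA of_int_hom.mat_hom_mult[OF B A] by (metis of_int_hom.mat_hom_one)
  then have "?r A * ?r B = 1\<^sub>m n"
    using A B by (intro mat_mult_left_right_inverse[of "?r B" n "?r A"]) auto
  then have "?r (A * B) = ?r (1\<^sub>m n)"
    using of_int_hom.mat_hom_mult[OF A B] of_int_hom.mat_hom_one by metis
  then show ?thesis by (rule of_int_hom.mat_hom_inj)
qed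

section \<open>The integral symplectic group\<close>

lemma symp_form_carrier [simp]: "symp_form g \<in> carrier_mat (2 * g) (2 * g)"
  by (simp add: symp_form_def)

lemma dim_symp_form [simp]: "dim_row (symp_form g) = 2 * g" "dim_col (symp_form g) = 2 * g"
  by (simp_all add: symp_form_def)

lemma ext_vec_col_symp_form:
  assumes "b < 2 * g"
  shows "ext_vec (col (symp_form g) b) = (if even b then - frag_of {Suc b} else frag_of {b - 1})"
proof -
  have "ext_vec (col (symp_form g) b) =
      (\<Sum>a<2*g. frag_cmul (if even a \<and> b = Suc a then 1 else if even b \<and> a = Suc b then -1 else 0) (frag_of {a}))"
    unfolding ext_vec_def using assms by (intro sum.cong) (auto simp: symp_form_def)
  also have "\<dots> = (\<Sum>a<2*g. if a = (if even b then Suc b else b - 1)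
      then (if even b then - frag_of {Suc b} else frag_of {b - 1}) else 0)"
    by (intro sum.cong) (auto elim: oddE)
  also have "\<dots> = (if even b then - frag_of {Suc b} else frag_of {b - 1})"
  proof -
    have "(if even b then Suc b else b - 1) < 2 * g" using assms by (auto elim!: evenE)
    then show ?thesis by simp
  qed
  finally show ?thesis .
qed

lemma symp_form_square: "symp_form g * symp_form g = - 1\<^sub>m (2 * g)"
proof (rule eq_matI)
  fix i j assume "i < dim_row (- 1\<^sub>m (2 * g) :: int mat)" "j < dim_col (- 1\<^sub>m (2 * g) :: int mat)"
  then have ij: "i < 2 * g" "j < 2 * g" by auto
  \<comment> \<open>\<open>s\<close> exchanges the two indices of a hyperbolic pair; row i of the
    form has its only nonzero entry in column \<open>s i\<close>.\<close>
  define s where "s = (\<lambda>i::nat. if even i then Suc i else i - 1)"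
  have s: "s i < 2 * g" using ij(1) by (auto simp: s_def elim!: evenE)
  have "(symp_form g * symp_form g) $$ (i, j) =
      (\<Sum>k<2*g. symp_form g $$ (i, k) * symp_form g $$ (k, j))"
    using ij by (simp add: scalar_prod_def symp_form_def lessThan_atLeast0)
  also have "\<dots> = (\<Sum>k<2*g. if k = s i then (if i = j then -1 else 0) else 0)"
    using ij by (intro sum.cong refl) (auto simp: symp_form_def s_def, presburger+)
  also have "\<dots> = (- 1\<^sub>m (2 * g)) $$ (i, j)" using s ij by auto
  finally show "(symp_form g * symp_form g) $$ (i, j) = (- 1\<^sub>m (2 * g)) $$ (i, j)" .
qed (auto simp: symp_form_def)

lemma Sp_iff: "A \<in> carrier (Sp g) \<longleftrightarrow>
    A \<in> carrier_mat (2 * g) (2 * g) \<and> A\<^sup>T * symp_form g * A = symp_form g"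
  by (simp add: Sp_def)

text \<open>Write J for the form. Since J J = -1, the relation A^T J A = J is solved by the inverse
  J^-1 A^T J = - J A^T J.\<close>

definition symp_inv :: "nat \<Rightarrow> int mat \<Rightarrow> int mat" where
  "symp_inv g A = - (symp_form g * A\<^sup>T * symp_form g)"

lemma symp_inv_carrier [simp]:
  "A \<in> carrier_mat (2 * g) (2 * g) \<Longrightarrow> symp_inv g A \<in> carrier_mat (2 * g) (2 * g)"
  unfolding symp_inv_def by (intro uminus_carrier_mat mult_carrier_mat) auto

lemma symp_inv_left:
  assumes "A \<in> carrier (Sp g)"
  shows "symp_inv g A * A = 1\<^sub>m (2 * g)"
proof -
  let ?J = "symp_form g" and ?n = "2 * g"
  have A: "A \<in> carrier_mat ?n ?n" "A\<^sup>T * ?J * A = ?J" using assms by (auto simp: Sp_iff)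
  have AT: "A\<^sup>T \<in> carrier_mat ?n ?n" using A by simp
  have J: "?J \<in> carrier_mat ?n ?n" by simp
  have "symp_inv g A * A = - (?J * A\<^sup>T * ?J * A)"
    unfolding symp_inv_def using A(1) AT J by (intro uminus_mult_left_mat) auto
  also have "?J * A\<^sup>T * ?J * A = ?J * (A\<^sup>T * ?J * A)"
    using A(1) AT J by (simp add: assoc_mult_mat[of _ ?n ?n _ ?n _ ?n] mult_carrier_mat[of _ ?n ?n _ ?n])
  also have "- \<dots> = 1\<^sub>m ?n" by (simp add: A(2) symp_form_square)
  finally show ?thesis .
qed

lemma symp_inv_right:
  assumes "A \<in> carrier (Sp g)"
  shows "A * symp_inv g A = 1\<^sub>m (2 * g)"
proof -
  have A: "A \<in> carrier_mat (2 * g) (2 * g)" using assms by (simp add: Sp_iff)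
  show ?thesis
    by (rule mat_left_inverse_imp_right_inverse[OF A symp_inv_carrier[OF A] symp_inv_left[OF assms]])
qed

text \<open>The group is closed under transposition: write out A A^-1 = 1 and multiply by J on the
  right. This version is needed because A acts on bivectors by M \<mapsto> A M A^T, whereas the
  group is defined by A^T J A = J.\<close>

lemma Sp_transpose:
  assumes "A \<in> carrier (Sp g)"
  shows "A * symp_form g * A\<^sup>T = symp_form g"
proof -
  let ?J = "symp_form g" and ?n = "2 * g"
  have A: "A \<in> carrier_mat ?n ?n" using assms by (auto simp: Sp_iff)
  have AT: "A\<^sup>T \<in> carrier_mat ?n ?n" using A by simp
  have J: "?J \<in> carrier_mat ?n ?n" by simp
  have X: "A * ?J * A\<^sup>T \<in> carrier_mat ?n ?n" using A AT J by auto
  have "A * symp_inv g A = - (A * (?J * A\<^sup>T * ?J))"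
    unfolding symp_inv_def using A AT J by (intro uminus_mult_right_mat) auto
  also have "A * (?J * A\<^sup>T * ?J) = A * ?J * A\<^sup>T * ?J"
    using A AT J by (simp add: assoc_mult_mat[of _ ?n ?n _ ?n _ ?n] mult_carrier_mat[of _ ?n ?n _ ?n])
  finally have "- (A * ?J * A\<^sup>T * ?J) = 1\<^sub>m ?n" using symp_inv_right[OF assms] by simp
  then have "A * ?J * A\<^sup>T * ?J = - 1\<^sub>m ?n" by (metis uminus_uminus_mat)
  then have "(A * ?J * A\<^sup>T * ?J) * ?J = - ?J"
    using J by simp
  moreover have "(A * ?J * A\<^sup>T * ?J) * ?J = - (A * ?J * A\<^sup>T)"
    unfolding assoc_mult_mat[OF X J J] symp_form_square
    using A X right_mult_one_mat[OF X] by simp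
  ultimately show ?thesis by (metis uminus_uminus_mat)
qed

lemma symp_inv_in_Sp:
  assumes "A \<in> carrier (Sp g)"
  shows "symp_inv g A \<in> carrier (Sp g)"
proof -
  let ?J = "symp_form g" and ?n = "2 * g" and ?B = "symp_inv g A"
  have A: "A \<in> carrier_mat ?n ?n" "A\<^sup>T * ?J * A = ?J" using assms by (auto simp: Sp_iff)
  have AT: "A\<^sup>T \<in> carrier_mat ?n ?n" using A by simp
  have J: "?J \<in> carrier_mat ?n ?n" by simp
  have B: "?B \<in> carrier_mat ?n ?n" using A by simp
  have BT: "?B\<^sup>T \<in> carrier_mat ?n ?n" using B by simp
  have BA: "?B\<^sup>T * A\<^sup>T = 1\<^sub>m ?n"
    using transpose_mult[OF A(1) B] symp_inv_right[OF assms] by simp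
  have "?B\<^sup>T * ?J * ?B = ?B\<^sup>T * (A\<^sup>T * ?J * A) * ?B" by (simp add: A(2))
  also have "\<dots> = (?B\<^sup>T * A\<^sup>T) * ?J * (A * ?B)"
    using A(1) AT J B BT
    by (simp add: assoc_mult_mat[of _ ?n ?n _ ?n _ ?n] mult_carrier_mat[of _ ?n ?n _ ?n])
  also have "\<dots> = ?J"
    unfolding BA symp_inv_right[OF assms] by simp
  finally show ?thesis using B by (simp add: Sp_iff)
qed

lemma Sp_mult_closed:
  assumes "A \<in> carrier (Sp g)" "B \<in> carrier (Sp g)"
  shows "A * B \<in> carrier (Sp g)"
proof -
  let ?J = "symp_form g" and ?n = "2 * g"
  have A: "A \<in> carrier_mat ?n ?n" "A\<^sup>T * ?J * A = ?J" using assms by (auto simp: Sp_iff)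
  have B: "B \<in> carrier_mat ?n ?n" "B\<^sup>T * ?J * B = ?J" using assms by (auto simp: Sp_iff)
  have AT: "A\<^sup>T \<in> carrier_mat ?n ?n" "B\<^sup>T \<in> carrier_mat ?n ?n" using A B by auto
  have J: "?J \<in> carrier_mat ?n ?n" by simp
  have "(A * B)\<^sup>T * ?J * (A * B) = B\<^sup>T * (A\<^sup>T * ?J * A) * B"
    using A(1) AT J B(1) by (simp add: transpose_mult assoc_mult_mat[of _ ?n ?n _ ?n _ ?n] mult_carrier_mat[of _ ?n ?n _ ?n])
  then show ?thesis using A B by (simp add: Sp_iff)
qed

lemma group_Sp: "group (Sp g)"
proof (rule groupI)
  fix A assume A: "A \<in> carrier (Sp g)"
  show "\<exists>B\<in>carrier (Sp g). B \<otimes>\<^bsub>Sp g\<^esub> A = \<one>\<^bsub>Sp g\<^esub>"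
    using symp_inv_in_Sp[OF A] symp_inv_left[OF A] by (intro bexI) (auto simp: Sp_def)
next
  fix A B C assume "A \<in> carrier (Sp g)" "B \<in> carrier (Sp g)" "C \<in> carrier (Sp g)"
  then show "A \<otimes>\<^bsub>Sp g\<^esub> B \<otimes>\<^bsub>Sp g\<^esub> C = A \<otimes>\<^bsub>Sp g\<^esub> (B \<otimes>\<^bsub>Sp g\<^esub> C)"
    by (simp add: Sp_def assoc_mult_mat[of _ "2 * g" "2 * g" _ "2 * g" _ "2 * g"])
next
  show "\<one>\<^bsub>Sp g\<^esub> \<in> carrier (Sp g)"
    using left_mult_one_mat[OF symp_form_carrier] right_mult_one_mat[OF symp_form_carrier]
    by (simp add: Sp_def)
next
  fix A B assume "A \<in> carrier (Sp g)" "B \<in> carrier (Sp g)"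
  then show "A \<otimes>\<^bsub>Sp g\<^esub> B \<in> carrier (Sp g)" using Sp_mult_closed[of A g B] by (simp add: Sp_def)
next
  fix A assume "A \<in> carrier (Sp g)"
  then show "\<one>\<^bsub>Sp g\<^esub> \<otimes>\<^bsub>Sp g\<^esub> A = A" using left_mult_one_mat[of A "2 * g" "2 * g"] by (simp add: Sp_def)
qed

text \<open>With Q the identity this is the bivector \<Sum> P_ab e_a \<and> e_b of the matrix P; in
  general, for square matrices of equal size, it is the bivector of P Q^T.\<close>

definition bivector :: "int mat \<Rightarrow> int mat \<Rightarrow> ext" where
  "bivector P Q = (\<Sum>b<dim_col P. ext_vec (col P b) \<and>\<and> ext_vec (col Q b))"

lemma bivector_transpose:
  assumes "P \<in> carrier_mat n n" "Q \<in> carrier_mat n n"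
  shows "bivector P Q = bivector (P * Q\<^sup>T) (1\<^sub>m n)"
proof -
  have QT: "Q\<^sup>T \<in> carrier_mat n n" using assms by simp
  have "bivector P Q = (\<Sum>b<n. \<Sum>d<n. frag_cmul (Q $$ (d, b)) (ext_vec (col P b) \<and>\<and> frag_of {d}))"
    using assms by (simp add: bivector_def ext_vec_def[of "col Q _"] wedge_sum_right wedge_cmul_right del: wedge_frag_of)
  also have "\<dots> = (\<Sum>d<n. \<Sum>b<n. frag_cmul (Q $$ (d, b)) (ext_vec (col P b) \<and>\<and> frag_of {d}))"
    by (rule sum.swap)
  also have "\<dots> = (\<Sum>d<n. ext_vec (P *\<^sub>v col Q\<^sup>T d) \<and>\<and> frag_of {d})"
  proof (rule sum.cong[OF refl])
    fix d assume "d \<in> {..<n}"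
    then show "(\<Sum>b<n. frag_cmul (Q $$ (d, b)) (ext_vec (col P b) \<and>\<and> frag_of {d})) =
        ext_vec (P *\<^sub>v col Q\<^sup>T d) \<and>\<and> frag_of {d}"
      using assms by (subst ext_vec_mult_mat_vec[OF assms(1)])
        (auto simp: wedge_sum_left wedge_cmul_left intro!: sum.cong)
  qed
  also have "\<dots> = bivector (P * Q\<^sup>T) (1\<^sub>m n)"
    unfolding bivector_def using assms
    by (intro sum.cong) (auto simp: ext_vec_unit_vec col_mult2[OF assms(1) QT] simp del: wedge_frag_of)
  finally show ?thesis .
qed

lemma ext_map_bivector:
  assumes "A \<in> carrier_mat n n" "P \<in> carrier_mat n n" "Q \<in> carrier_mat n n"
  shows "ext_map A (bivector P Q) = bivector (A * P) (A * Q)"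
  unfolding bivector_def using assms
  by (auto simp: ext_map_sum ext_map_wedge ext_map_ext_vec[OF assms(1)] col_mult2[OF assms(1,2)]
      col_mult2[OF assms(1,3)] intro!: sum.cong)

lemma sum_lessThan_double: "(\<Sum>b<2 * g. f b) = (\<Sum>i<g. f (2 * i) + f (Suc (2 * i)))"
  for f :: "nat \<Rightarrow> 'a::comm_monoid_add"
  by (induction g) (simp_all add: add.assoc)

text \<open>The factor 2 arises because each hyperbolic pair is met from both of its indices, and
  the antisymmetry of the form makes the two contributions equal.\<close>

lemma bivector_symp_form: "bivector (symp_form g) (1\<^sub>m (2 * g)) = frag_cmul 2 (symp_elt g)"
proof -
  have "bivector (symp_form g) (1\<^sub>m (2 * g)) =
      (\<Sum>b<2 * g. (if even b then - frag_of {Suc b} else frag_of {b - 1}) \<and>\<and> frag_of {b})"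
    unfolding bivector_def
    by (intro sum.cong) (auto simp: ext_vec_col_symp_form ext_vec_unit_vec simp del: wedge_frag_of)
  also have "\<dots> = (\<Sum>i<g. frag_cmul 2 (pair_elt i))"
    unfolding sum_lessThan_double
    by (intro sum.cong)
      (auto simp: wedge_minus_left frag_of_wedge_pair frag_of_wedge_pair_swap frag_cmul_2 simp del: wedge_frag_of)
  also have "\<dots> = frag_cmul 2 (symp_elt g)"
    by (simp add: symp_elt_def frag_of_wedge_pair frag_cmul_sum del: wedge_frag_of)
  finally show ?thesis .
qed

lemma frag_cmul_cancel: "frag_cmul c x = frag_cmul c y \<Longrightarrow> c \<noteq> 0 \<Longrightarrow> x = y"
  by (metis lookup_frag_cmul mult_left_cancel poly_mapping_eqI)

text \<open>The bivector of J goes to that of A J A^T = J. This gives invariance of 2 \<omega>, and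
  the 2 cancels.\<close>

lemma ext_map_symp_elt:
  assumes "A \<in> carrier (Sp g)"
  shows "ext_map A (symp_elt g) = symp_elt g"
proof -
  let ?J = "symp_form g" and ?n = "2 * g"
  have A: "A \<in> carrier_mat ?n ?n" using assms by (simp add: Sp_iff)
  have "frag_cmul 2 (ext_map A (symp_elt g)) = bivector (A * ?J) (A * 1\<^sub>m ?n)"
    unfolding ext_map_cmul[symmetric] bivector_symp_form[symmetric]
    by (rule ext_map_bivector[OF A]) simp_all
  also have "\<dots> = bivector (A * ?J * A\<^sup>T) (1\<^sub>m ?n)"
    using A bivector_transpose[of "A * ?J" ?n A] by simp
  also have "\<dots> = frag_cmul 2 (symp_elt g)"
    by (simp add: Sp_transpose[OF assms] bivector_symp_form)
  finally show ?thesis by (rule frag_cmul_cancel) simp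
qed

section \<open>Free abelian groups and modules\<close>

text \<open>Induction on the rank: the elements with s-coordinate 0 form a subgroup H' of smaller
  rank, and H is the direct sum of H' and at most one infinite cyclic group. Evaluation of formal
  combinations, \<open>frag_extend id\<close>, expresses spanning and independence.\<close>

lemma subgroup_of_finite_rank_basis:
  fixes S :: "'a set" and H :: "('a \<Rightarrow>\<^sub>0 int) set"
  assumes "finite S" "\<And>x. x \<in> H \<Longrightarrow> Poly_Mapping.keys x \<subseteq> S" "0 \<in> H"
    "\<And>x y. x \<in> H \<Longrightarrow> y \<in> H \<Longrightarrow> x - y \<in> H"
  shows "\<exists>B\<subseteq>H. (\<forall>x\<in>H. \<exists>c. Poly_Mapping.keys c \<subseteq> B \<and> frag_extend id c = x) \<and>
    (\<forall>c. Poly_Mapping.keys c \<subseteq> B \<longrightarrow> frag_extend id c = 0 \<longrightarrow> c = 0)"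
  using assms
proof (induction S arbitrary: H rule: finite_induct)
  case empty
  then have "\<forall>x\<in>H. x = 0" by auto
  then show ?case by (intro exI[of _ "{}"]) auto
next
  case (insert s S)
  let ?l = "\<lambda>x. poly_mapping.lookup x s"
  define H' where "H' = {x \<in> H. ?l x = 0}"
  have minus: "- x \<in> H" if "x \<in> H" for x using insert.prems(3)[OF insert.prems(2) that] by simp
  have add: "x + y \<in> H" if "x \<in> H" "y \<in> H" for x y using insert.prems(3)[OF that(1) minus[OF that(2)]] by simp
  have keys: "Poly_Mapping.keys x \<subseteq> S" if "x \<in> H'" for x
    using that insert.prems(1)[of x] by (auto simp: H'_def in_keys_iff)
  have "\<exists>B\<subseteq>H'. (\<forall>x\<in>H'. \<exists>c. Poly_Mapping.keys c \<subseteq> B \<and> frag_extend id c = x) \<and>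
      (\<forall>c. Poly_Mapping.keys c \<subseteq> B \<longrightarrow> frag_extend id c = 0 \<longrightarrow> c = 0)"
    by (rule insert.IH[OF keys]) (use insert.prems(2,3) in \<open>simp_all add: H'_def lookup_minus\<close>)
  then obtain B' where B': "B' \<subseteq> H'"
    "\<And>x. x \<in> H' \<Longrightarrow> \<exists>c. Poly_Mapping.keys c \<subseteq> B' \<and> frag_extend id c = x"
    "\<And>c. Poly_Mapping.keys c \<subseteq> B' \<Longrightarrow> frag_extend id c = 0 \<Longrightarrow> c = 0"
    by blast
  show ?case
  proof (cases "H \<subseteq> H'")
    case True
    then have "H = H'" by (auto simp: H'_def)
    then show ?thesis using B' by blast
  next
    case False
    then obtain x where x: "x \<in> H" "?l x \<noteq> 0" by (auto simp: H'_def)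
    \<comment> \<open>The s-coordinates of H form a nonzero subgroup of the integers; d is its
      positive generator.\<close>
    define d where "d = (LEAST n. n > 0 \<and> (\<exists>x\<in>H. ?l x = int n))"
    have "\<exists>n>0. \<exists>x\<in>H. ?l x = int n"
    proof (cases "?l x > 0")
      case True
      then show ?thesis using x by (intro exI[of _ "nat (?l x)"]) auto
    next
      case False
      then show ?thesis using x minus[OF x(1)] by (intro exI[of _ "nat (- ?l x)"]) (auto intro!: bexI[of _ "- x"])
    qed
    then have "d > 0 \<and> (\<exists>x\<in>H. ?l x = int d)" unfolding d_def by (rule LeastI_ex)
    then obtain b where b: "b \<in> H" "?l b = int d" "d > 0" by auto
    have cmul: "frag_cmul q b \<in> H" for q
      using frag_closure_minus_cmul[of "\<lambda>x. x \<in> H"] insert.prems(2,3) b(1) by blast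
    \<comment> \<open>A remainder modulo d is again an s-coordinate of H, so minimality of d forces
      it to be 0.\<close>
    have dvd: "?l x - (?l x div int d) * int d = 0" if "x \<in> H" for x
    proof (rule ccontr)
      assume *: "?l x - (?l x div int d) * int d \<noteq> 0"
      then have mod: "?l x mod int d \<noteq> 0" by (simp add: minus_div_mult_eq_mod)
      have "?l (x - frag_cmul (?l x div int d) b) = int (nat (?l x mod int d))"
        using b by (simp add: lookup_minus minus_div_mult_eq_mod)
      moreover have "x - frag_cmul (?l x div int d) b \<in> H" using insert.prems(3) that cmul by blast
      moreover have "nat (?l x mod int d) > 0" using mod b(3) pos_mod_sign[of "int d" "?l x"] by (simp add: order_le_less)
      ultimately have "d \<le> nat (?l x mod int d)" unfolding d_def by (intro Least_le) auto
      then show False using b(3) pos_mod_bound[of "int d" "?l x"] by linarith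
    qed
    have "b \<notin> B'" using B'(1) b by (auto simp: H'_def)
    show ?thesis
    proof (intro exI[of _ "insert b B'"] conjI ballI allI impI)
      show "insert b B' \<subseteq> H" using b B'(1) by (auto simp: H'_def)
    next
      fix x assume x: "x \<in> H"
      let ?q = "?l x div int d"
      have "x - frag_cmul ?q b \<in> H'"
        using insert.prems(3)[OF x cmul] dvd[OF x] b(2) by (simp add: H'_def lookup_minus)
      then obtain c where c: "Poly_Mapping.keys c \<subseteq> B'" "frag_extend id c = x - frag_cmul ?q b"
        using B'(2) by blast
      show "\<exists>c. Poly_Mapping.keys c \<subseteq> insert b B' \<and> frag_extend id c = x"
      proof (intro exI conjI)
        show "frag_extend id (c + frag_cmul ?q (frag_of b)) = x"
          by (simp add: frag_extend_add frag_extend_cmul c(2))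
        show "Poly_Mapping.keys (c + frag_cmul ?q (frag_of b)) \<subseteq> insert b B'"
          using keys_add[of c "frag_cmul ?q (frag_of b)"] c(1) keys_cmul[of ?q "frag_of b"] by auto
      qed
    next
      fix c assume c: "Poly_Mapping.keys c \<subseteq> insert b B'" "frag_extend id c = 0"
      define q where "q = poly_mapping.lookup c b"
      define c' where "c' = c - frag_cmul q (frag_of b)"
      have "poly_mapping.lookup c' b = 0" by (simp add: c'_def q_def lookup_minus)
      then have c': "Poly_Mapping.keys c' \<subseteq> B'"
        using c(1) keys_diff[of c "frag_cmul q (frag_of b)"] keys_cmul[of q "frag_of b"]
        by (auto simp: c'_def[symmetric] in_keys_iff)
      \<comment> \<open>Comparing s-coordinates: combinations of \<open>B'\<close> have coordinate
        0, while q b has q d, so q = 0.\<close>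
      have "?l (frag_extend id c') = 0"
        using c' by (induction c' rule: frag_induction)
          (use B'(1) in \<open>auto simp: frag_extend_diff lookup_minus H'_def\<close>)
      moreover have "frag_extend id c' = - frag_cmul q b"
        using c(2) by (simp add: c'_def frag_extend_diff frag_extend_cmul)
      ultimately have "q = 0" using b by simp
      then show "c = 0" using B'(3)[OF c'] c(2) by (simp add: c'_def)
    qed
  qed
qed

lemma is_free_abelian_subgroup:
  assumes "finite S" "subgroup H (free_Abelian_group S)"
  shows "is_free_abelian (free_Abelian_group S\<lparr>carrier := H\<rparr>)"
proof -
  let ?F = "free_Abelian_group S"
  have sub: "Poly_Mapping.keys x \<subseteq> S" if "x \<in> H" for x
    using subgroup.mem_carrier[OF assms(2) that] by simp
  have zero: "0 \<in> H" using subgroup.one_closed[OF assms(2)] by simp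
  have diff: "x - y \<in> H" if "x \<in> H" "y \<in> H" for x y
    using subgroup.m_closed[OF assms(2) that(1) subgroup.m_inv_closed[OF assms(2) that(2)]] sub[OF that(2)]
    by simp
  obtain B where B: "B \<subseteq> H" "\<And>x. x \<in> H \<Longrightarrow> \<exists>c. Poly_Mapping.keys c \<subseteq> B \<and> frag_extend id c = x"
    "\<And>c. Poly_Mapping.keys c \<subseteq> B \<Longrightarrow> frag_extend id c = 0 \<Longrightarrow> c = 0"
    using subgroup_of_finite_rank_basis[OF assms(1) sub zero diff] by blast
  have mem: "frag_extend id c \<in> H" if "Poly_Mapping.keys c \<subseteq> B" for c
    using that by (induction c rule: frag_induction) (use zero diff B(1) in \<open>auto simp: frag_extend_diff\<close>)
  have "frag_extend id \<in> iso (free_Abelian_group B) (?F\<lparr>carrier := H\<rparr>)"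
  proof (rule isoI)
    show "frag_extend id \<in> hom (free_Abelian_group B) (?F\<lparr>carrier := H\<rparr>)"
      by (rule homI) (auto simp: mem frag_extend_add)
    have "inj_on (frag_extend id) {c. Poly_Mapping.keys c \<subseteq> B}"
    proof (rule inj_onI)
      fix c c' :: "('a \<Rightarrow>\<^sub>0 int) \<Rightarrow>\<^sub>0 int"
      assume "c \<in> {c. Poly_Mapping.keys c \<subseteq> B}" "c' \<in> {c. Poly_Mapping.keys c \<subseteq> B}"
        "frag_extend id c = frag_extend id c'"
      then have "c - c' = 0"
        using keys_diff[of c c'] by (intro B(3)) (auto simp: frag_extend_diff)
      then show "c = c'" by simp
    qed
    moreover have "frag_extend id ` {c. Poly_Mapping.keys c \<subseteq> B} = H" using mem B(2) by blast
    ultimately show "bij_betw (frag_extend id) (carrier (free_Abelian_group B)) (carrier (?F\<lparr>carrier := H\<rparr>))"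
      by (simp add: bij_betw_def free_Abelian_group_def)
  qed
  moreover have "group (?F\<lparr>carrier := H\<rparr>)"
    by (rule subgroup.subgroup_is_group[OF assms(2) group_free_Abelian_group])
  ultimately show ?thesis
    unfolding is_free_abelian_def using group.iso_sym[OF group_free_Abelian_group] is_isoI by blast
qed

text \<open>\<open>is_free_abelian\<close> takes the basis index set from the type of the group
  elements; the injection \<open>f\<close> moves that set between the two types.\<close>

lemma is_free_abelian_iso:
  fixes M :: "'a monoid" and N :: "'b monoid" and f :: "'b \<Rightarrow> 'a"
  assumes "M \<cong> N" "is_free_abelian N" "inj f"
  shows "is_free_abelian M"
proof -
  obtain S :: "'b set" where S: "N \<cong> free_Abelian_group S" using assms(2) by (auto simp: is_free_abelian_def)
  have "S \<approx> f ` S" using assms(3) by (meson inj_on_image_eqpoll_self eqpoll_sym inj_on_subset subset_UNIV)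
  then have "free_Abelian_group S \<cong> free_Abelian_group (f ` S)"
    by (simp add: isomorphic_free_Abelian_groups)
  from iso_trans[OF iso_trans[OF assms(1) S] this] show ?thesis
    unfolding is_free_abelian_def by (rule exI)
qed

text \<open>The bijectivity demanded by \<open>AutoGroup\<close> follows from the other axioms: the
  inverse group element acts as the inverse map.\<close>

lemma group_moduleI:
  assumes "group G" "comm_group M"
    and closed: "\<And>a x. a \<in> carrier G \<Longrightarrow> x \<in> carrier M \<Longrightarrow> \<rho> a x \<in> carrier M"
    and mult: "\<And>a x y. a \<in> carrier G \<Longrightarrow> x \<in> carrier M \<Longrightarrow> y \<in> carrier M \<Longrightarrow>
      \<rho> a (x \<otimes>\<^bsub>M\<^esub> y) = \<rho> a x \<otimes>\<^bsub>M\<^esub> \<rho> a y"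
    and comp: "\<And>a b x. a \<in> carrier G \<Longrightarrow> b \<in> carrier G \<Longrightarrow> x \<in> carrier M \<Longrightarrow>
      \<rho> (a \<otimes>\<^bsub>G\<^esub> b) x = \<rho> a (\<rho> b x)"
    and one: "\<And>x. x \<in> carrier M \<Longrightarrow> \<rho> \<one>\<^bsub>G\<^esub> x = x"
  shows "group_module G M \<rho>"
proof -
  interpret G: group G by fact
  interpret M: comm_group M by fact
  have bij: "bij_betw (\<rho> a) (carrier M) (carrier M)" if a: "a \<in> carrier G" for a
    by (rule bij_betwI[where g = "\<rho> (inv\<^bsub>G\<^esub> a)"]) (use a in \<open>auto simp: closed one simp flip: comp\<close>)
  have Bij: "restrict (\<rho> a) (carrier M) \<in> Bij (carrier M)" if "a \<in> carrier G" for a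
    using bij[OF that] by (simp add: Bij_def)
  have in_auto: "restrict (\<rho> a) (carrier M) \<in> auto M" if "a \<in> carrier G" for a
    using Bij[OF that] that by (auto simp: auto_def hom_def closed mult)
  have "(\<lambda>a. restrict (\<rho> a) (carrier M)) \<in> hom G (AutoGroup M)"
  proof (rule homI)
    fix a b assume ab: "a \<in> carrier G" "b \<in> carrier G"
    then show "restrict (\<rho> (a \<otimes>\<^bsub>G\<^esub> b)) (carrier M) =
        restrict (\<rho> a) (carrier M) \<otimes>\<^bsub>AutoGroup M\<^esub> restrict (\<rho> b) (carrier M)"
      by (auto simp: AutoGroup_def BijGroup_def Bij compose_def comp closed fun_eq_iff)
  qed (simp add: AutoGroup_def in_auto)
  then show ?thesis using assms(1,2) by (simp add: group_module_def)
qed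

section \<open>The Lefschetz filtration\<close>

text \<open>The power of \<omega> is a factorial times the divided power, and the factorial
  cancels.\<close>

lemma lefschetz_iff:
  "x \<in> lefschetz g r m \<longleftrightarrow>
    x \<in> ext_part (2 * g) (int m) \<and> symp_div g (nat (int g - int m + r + 1)) \<and>\<and> x = 0"
  by (auto simp: lefschetz_def carrier_ext_power wedge_power_symp_elt wedge_cmul_left)

lemma ext_power_simps [simp]:
  "x \<otimes>\<^bsub>ext_power n m\<^esub> y = x + y" "\<one>\<^bsub>ext_power n m\<^esub> = 0"
  by (simp_all add: ext_power_def)

lemma comm_group_ext_power: "comm_group (ext_power n m)"
  by (simp add: ext_power_def abelian_free_Abelian_group)

lemma inv_ext_power:
  assumes "x \<in> ext_part n (int m)"
  shows "inv\<^bsub>ext_power n m\<^esub> x = - x"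
  using assms unfolding ext_power_def by (subst inv_free_Abelian_group) (auto simp: ext_part_def)

lemma subgroup_lefschetz: "subgroup (lefschetz g r m) (ext_power (2 * g) m)"
proof -
  interpret comm_group "ext_power (2 * g) m" by (rule comm_group_ext_power)
  show ?thesis
  proof (rule subgroupI)
    have "0 \<in> lefschetz g r m" by (simp add: lefschetz_iff)
    then show "lefschetz g r m \<noteq> {}" by blast
  qed (auto simp: lefschetz_iff carrier_ext_power inv_ext_power ext_part_minus ext_part_add
      wedge_minus_right wedge_add_right)
qed

lemma lefschetz_group_simps [simp]:
  "carrier (lefschetz_group g r m) = lefschetz g r m"
  "x \<otimes>\<^bsub>lefschetz_group g r m\<^esub> y = x + y" "\<one>\<^bsub>lefschetz_group g r m\<^esub> = 0"
  by (simp_all add: lefschetz_group_def)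

lemma comm_group_lefschetz_group: "comm_group (lefschetz_group g r m)"
  unfolding lefschetz_group_def
proof (rule group.group_comm_groupI)
  show "group (ext_power (2 * g) m\<lparr>carrier := lefschetz g r m\<rparr>)"
    by (rule subgroup.subgroup_is_group[OF subgroup_lefschetz comm_group.axioms(2)[OF comm_group_ext_power]])
qed (simp add: add.commute)

lemma lefschetz_step_subset: "lefschetz g (r - 1) m \<subseteq> lefschetz g r m"
proof
  fix x assume x: "x \<in> lefschetz g (r - 1) m"
  let ?e = "int g - int m + r"
  have fin: "ext_finite x" using x by (auto simp: lefschetz_iff intro: ext_part_finite)
  have pred: "int g - int m + (r - 1) + 1 = ?e" by simp
  show "x \<in> lefschetz g r m"
  proof (cases "?e < 0")
    \<comment> \<open>\<open>nat\<close> truncates both exponents to 0, so the two steps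
      coincide.\<close>
    case True
    then have "nat (?e + 1) = nat ?e" by simp
    then show ?thesis using x unfolding lefschetz_iff pred by simp
  next
    case False
    then have e: "nat (?e + 1) = Suc (nat ?e)" by simp
    \<comment> \<open>One more factor \<omega> raises the divided power at the cost of a nonzero
      integer.\<close>
    have "frag_cmul (int (nat ?e) + 1) (symp_div g (Suc (nat ?e)) \<and>\<and> x) = 0"
      using x symp_elt_wedge_symp_div_wedge[OF fin, of g "nat ?e"] unfolding lefschetz_iff pred by simp
    then have "symp_div g (Suc (nat ?e)) \<and>\<and> x = 0" by (simp del: int_nat_eq)
    then show ?thesis using x unfolding lefschetz_iff e by simp
  qed
qed

lemma is_free_abelian_lefschetz_group: "is_free_abelian (lefschetz_group g r m)"
  using is_free_abelian_subgroup[of "{I. I \<subseteq> {..<2 * g} \<and> card I = m}" "lefschetz g r m"]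
    subgroup_lefschetz[of g r m]
  by (simp add: lefschetz_group_def ext_power_def)

text \<open>Invariance passes from \<omega> to its divided powers by cancelling j + 1 in \<omega>
  \<omega>^[j] = (j + 1) \<omega>^[j+1].\<close>

lemma ext_map_symp_div:
  assumes "A \<in> carrier (Sp g)"
  shows "ext_map A (symp_div g j) = symp_div g j"
proof (induction j)
  case (Suc j)
  have "frag_cmul (int j + 1) (ext_map A (symp_div g (Suc j))) = ext_map A (symp_elt g \<and>\<and> symp_div g j)"
    by (simp add: symp_elt_wedge_symp_div ext_map_cmul)
  also have "\<dots> = symp_elt g \<and>\<and> symp_div g j"
    using Suc by (simp add: ext_map_wedge ext_map_symp_elt[OF assms] del: symp_div.simps)
  also have "\<dots> = frag_cmul (int j + 1) (symp_div g (Suc j))"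
    by (rule symp_elt_wedge_symp_div)
  finally show ?case by (rule frag_cmul_cancel) simp
qed simp

lemma Sp_ext_map_in_ext_part:
  assumes "A \<in> carrier (Sp g)" "x \<in> ext_part (2 * g) d"
  shows "ext_map A x \<in> ext_part (2 * g) d"
  using ext_map_in_ext_part[OF assms(2), of A] assms(1) by (auto simp: Sp_iff)

lemma Sp_ext_map_symp_div_wedge:
  assumes "A \<in> carrier (Sp g)" "ext_finite x"
  shows "ext_map A (symp_div g j \<and>\<and> x) = symp_div g j \<and>\<and> ext_map A x"
  using assms by (simp add: ext_map_wedge ext_map_symp_div)

lemma ext_map_in_lefschetz:
  assumes "A \<in> carrier (Sp g)" "x \<in> lefschetz g r m"
  shows "ext_map A x \<in> lefschetz g r m"
proof -
  have x: "x \<in> ext_part (2 * g) (int m)" using assms(2) by (simp add: lefschetz_iff)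
  show ?thesis
    using assms(2) Sp_ext_map_in_ext_part[OF assms(1) x]
      Sp_ext_map_symp_div_wedge[OF assms(1) ext_part_finite[OF x], symmetric]
    by (simp add: lefschetz_iff)
qed

lemma Sp_simps [simp]: "A \<otimes>\<^bsub>Sp g\<^esub> B = A * B" "\<one>\<^bsub>Sp g\<^esub> = 1\<^sub>m (2 * g)"
  by (simp_all add: Sp_def)

lemma Sp_ext_map_mult:
  assumes "A \<in> carrier (Sp g)" "B \<in> carrier (Sp g)" "x \<in> lefschetz g r m"
  shows "ext_map (A * B) x = ext_map A (ext_map B x)"
  using assms by (intro ext_map_mult[of _ "2 * g"]) (auto simp: Sp_iff lefschetz_iff)

lemma ext_map_one_lefschetz: "x \<in> lefschetz g r m \<Longrightarrow> ext_map (1\<^sub>m (2 * g)) x = x"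
  using ext_map_one_mat by (auto simp: lefschetz_iff)

lemma group_module_lefschetz: "group_module (Sp g) (lefschetz_group g r m) ext_map"
  by (rule group_moduleI)
    (auto simp: group_Sp comm_group_lefschetz_group ext_map_in_lefschetz ext_map_add
      Sp_ext_map_mult ext_map_one_lefschetz)

text \<open>Equality, obtained from the inverse matrix, is what makes the direct image of a coset a
  full coset, so that direct image is an action on the subquotient.\<close>

lemma ext_map_image_lefschetz:
  assumes "A \<in> carrier (Sp g)"
  shows "ext_map A ` lefschetz g r m = lefschetz g r m"
proof
  show "ext_map A ` lefschetz g r m \<subseteq> lefschetz g r m" using ext_map_in_lefschetz[OF assms] by blast
  show "lefschetz g r m \<subseteq> ext_map A ` lefschetz g r m"
  proof
    fix x assume x: "x \<in> lefschetz g r m"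
    have "x = ext_map A (ext_map (symp_inv g A) x)"
      using Sp_ext_map_mult[OF assms symp_inv_in_Sp[OF assms] x] ext_map_one_lefschetz[OF x]
      by (simp add: symp_inv_right[OF assms])
    then show "x \<in> ext_map A ` lefschetz g r m"
      using ext_map_in_lefschetz[OF symp_inv_in_Sp[OF assms] x] by blast
  qed
qed

lemma normal_lefschetz: "lefschetz g (r - 1) m \<lhd> lefschetz_group g r m"
proof -
  interpret comm_group "lefschetz_group g r m" by (rule comm_group_lefschetz_group)
  have "subgroup (lefschetz g (r - 1) m) (lefschetz_group g r m)"
    unfolding lefschetz_group_def
    by (rule group.subgroup_incl[OF comm_group.axioms(2)[OF comm_group_ext_power]
          subgroup_lefschetz subgroup_lefschetz lefschetz_step_subset])
  then show ?thesis by (simp add: normal_iff_subgroup)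
qed

lemma ext_map_image_coset:
  assumes "A \<in> carrier (Sp g)"
  shows "ext_map A ` (lefschetz g s m #>\<^bsub>lefschetz_group g r m\<^esub> x) =
    lefschetz g s m #>\<^bsub>lefschetz_group g r m\<^esub> ext_map A x"
  (is "_ ` ?C = ?D")
proof -
  have coset: "lefschetz g s m #>\<^bsub>lefschetz_group g r m\<^esub> y = (\<lambda>z. z + y) ` lefschetz g s m" for y
    by (auto simp: r_coset_def)
  have "ext_map A ` ?C = (\<lambda>y. y + ext_map A x) ` (ext_map A ` lefschetz g s m)"
    unfolding coset image_image by (simp add: ext_map_add)
  then show ?thesis
    unfolding ext_map_image_lefschetz[OF assms] coset .
qed

lemma lefschetz_gr_carrierE:
  assumes "X \<in> carrier (lefschetz_gr g r m)"
  obtains x where "x \<in> lefschetz g r m" "X = lefschetz g (r - 1) m #>\<^bsub>lefschetz_group g r m\<^esub> x"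
  using assms by (auto simp: lefschetz_gr_def carrier_FactGroup)

lemma lefschetz_gr_cosetI:
  assumes "x \<in> lefschetz g r m"
  shows "lefschetz g (r - 1) m #>\<^bsub>lefschetz_group g r m\<^esub> x \<in> carrier (lefschetz_gr g r m)"
  using assms by (simp add: lefschetz_gr_def carrier_FactGroup)

lemma comm_group_lefschetz_gr: "comm_group (lefschetz_gr g r m)"
  unfolding lefschetz_gr_def
  by (rule comm_group.abelian_FactGroup[OF comm_group_lefschetz_group normal_imp_subgroup[OF normal_lefschetz]])

lemma group_module_lefschetz_gr:
  "group_module (Sp g) (lefschetz_gr g r m) (\<lambda>A X. ext_map A ` X)"
proof (rule group_moduleI)
  fix A X assume A: "A \<in> carrier (Sp g)" and X: "X \<in> carrier (lefschetz_gr g r m)"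
  from X show "ext_map A ` X \<in> carrier (lefschetz_gr g r m)"
    by (elim lefschetz_gr_carrierE)
      (simp add: ext_map_image_coset[OF A] lefschetz_gr_cosetI ext_map_in_lefschetz[OF A])
next
  fix A X Y assume A: "A \<in> carrier (Sp g)"
    and X: "X \<in> carrier (lefschetz_gr g r m)" and Y: "Y \<in> carrier (lefschetz_gr g r m)"
  obtain x where x: "x \<in> lefschetz g r m" "X = lefschetz g (r - 1) m #>\<^bsub>lefschetz_group g r m\<^esub> x"
    using lefschetz_gr_carrierE[OF X] .
  obtain y where y: "y \<in> lefschetz g r m" "Y = lefschetz g (r - 1) m #>\<^bsub>lefschetz_group g r m\<^esub> y"
    using lefschetz_gr_carrierE[OF Y] .
  note sum = normal.rcos_sum[OF normal_lefschetz, simplified]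
  show "ext_map A ` (X \<otimes>\<^bsub>lefschetz_gr g r m\<^esub> Y) =
      ext_map A ` X \<otimes>\<^bsub>lefschetz_gr g r m\<^esub> ext_map A ` Y"
    using x y
    by (simp add: lefschetz_gr_def sum ext_map_image_coset[OF A] ext_map_in_lefschetz[OF A] ext_map_add)
next
  fix A B X assume A: "A \<in> carrier (Sp g)" and B: "B \<in> carrier (Sp g)"
    and X: "X \<in> carrier (lefschetz_gr g r m)"
  obtain x where x: "x \<in> lefschetz g r m" "X = lefschetz g (r - 1) m #>\<^bsub>lefschetz_group g r m\<^esub> x"
    using lefschetz_gr_carrierE[OF X] .
  show "ext_map (A \<otimes>\<^bsub>Sp g\<^esub> B) ` X = ext_map A ` ext_map B ` X"
    using ext_map_image_coset[OF Sp_mult_closed[OF A B]] x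
    by (simp add: ext_map_image_coset A B Sp_ext_map_mult[OF A B])
next
  fix X assume X: "X \<in> carrier (lefschetz_gr g r m)"
  obtain x where x: "x \<in> lefschetz g r m" "X = lefschetz g (r - 1) m #>\<^bsub>lefschetz_group g r m\<^esub> x"
    using lefschetz_gr_carrierE[OF X] .
  have "1\<^sub>m (2 * g) \<in> carrier (Sp g)" using group.is_monoid[OF group_Sp[of g]] monoid.one_closed by fastforce
  then show "ext_map \<one>\<^bsub>Sp g\<^esub> ` X = X"
    using x by (simp add: ext_map_image_coset ext_map_one_lefschetz[OF x(1)])
qed (auto simp: group_Sp comm_group_lefschetz_gr)

text \<open>Divisibility also controls the quotient x: the equation \<omega> y = 0 reads (j + 1)
  \<omega>^[j+1] x = 0. The resulting condition on x is membership in a filtration step.\<close>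

lemma symp_div_wedge_kernel:
  assumes "y \<in> ext_part (2 * g) m" "symp_div g (Suc 0) \<and>\<and> y = 0" "int g + int j \<le> m"
    "int n = m - 2 * int j"
  obtains x where "x \<in> ext_part (2 * g) (int n)" "symp_div g j \<and>\<and> x = y" "symp_div g (Suc j) \<and>\<and> x = 0"
proof -
  obtain x where x: "x \<in> ext_part (2 * g) (int n)" "symp_div g j \<and>\<and> x = y"
    using symp_elt_kernel_divisible[OF assms(1) _ assms(3)] assms(2,4) by (auto simp: symp_elt_eq)
  have "frag_cmul (int j + 1) (symp_div g (Suc j) \<and>\<and> x) = 0"
    using symp_elt_wedge_symp_div_wedge[OF ext_part_finite[OF x(1)], of g j] x(2) assms(2)
    by (simp add: symp_elt_eq)
  then show ?thesis using that x by simp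
qed

lemma symp_div_Suc_0_wedge:
  assumes "ext_finite x" "symp_div g (Suc j) \<and>\<and> x = 0"
  shows "symp_div g (Suc 0) \<and>\<and> (symp_div g j \<and>\<and> x) = 0"
  using symp_elt_wedge_symp_div_wedge[OF assms(1), of g j] assms(2) by (simp add: symp_elt_eq)

section \<open>The isomorphism between the subquotient and the primitive part\<close>

context
  fixes g k r :: nat
  assumes kg: "k \<le> g" and rg: "r \<le> g - k"
begin

text \<open>With d = g - k, the exponents for F_r, F_(r-1) and P^k are d - r + 1, d - r and d + 1.
  The bounds on k and r keep them nonnegative, so no truncation occurs.\<close>

lemma lefschetz_r_iff: "x \<in> lefschetz g (int r) (k + 2 * r) \<longleftrightarrow>
    x \<in> ext_part (2 * g) (int (k + 2 * r)) \<and> symp_div g (Suc (g - k - r)) \<and>\<and> x = 0"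
proof -
  have "nat (int g - int (k + 2 * r) + int r + 1) = Suc (g - k - r)" using kg rg by simp
  then show ?thesis unfolding lefschetz_iff by simp
qed

lemma lefschetz_r_pred_iff: "x \<in> lefschetz g (int r - 1) (k + 2 * r) \<longleftrightarrow>
    x \<in> ext_part (2 * g) (int (k + 2 * r)) \<and> symp_div g (g - k - r) \<and>\<and> x = 0"
proof -
  have "nat (int g - int (k + 2 * r) + (int r - 1) + 1) = g - k - r" using kg rg by simp
  then show ?thesis unfolding lefschetz_iff by simp
qed

lemma primitive_iff: "z \<in> lefschetz g 0 k \<longleftrightarrow>
    z \<in> ext_part (2 * g) (int k) \<and> symp_div g (Suc (g - k)) \<and>\<and> z = 0"
proof -
  have "nat (int g - int k + 0 + 1) = Suc (g - k)" using kg by simp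
  then show ?thesis unfolding lefschetz_iff by simp
qed

text \<open>The graph of the isomorphism, lifted to F_r: x and z have the same image in K.\<close>

definition primitive_rel :: "ext \<Rightarrow> ext \<Rightarrow> bool" where
  "primitive_rel x z \<longleftrightarrow> z \<in> lefschetz g 0 k \<and> symp_div g (g - k) \<and>\<and> z = symp_div g (g - k - r) \<and>\<and> x"

text \<open>The image of x lies in degree 2g - k = g + d, exactly the bound for divisibility by
  \<omega>^[d].\<close>

lemma primitive_rel_ex:
  assumes "x \<in> lefschetz g (int r) (k + 2 * r)"
  shows "\<exists>z. primitive_rel x z"
proof -
  have x: "x \<in> ext_part (2 * g) (int (k + 2 * r))" "symp_div g (Suc (g - k - r)) \<and>\<and> x = 0"
    using assms by (auto simp: lefschetz_r_iff)
  have y: "symp_div g (g - k - r) \<and>\<and> x \<in> ext_part (2 * g) (int k + 2 * int (g - k))"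
    by (rule symp_div_wedge_in_ext_part[OF x(1)]) (use kg rg in simp)
  show ?thesis
    by (rule symp_div_wedge_kernel[OF y symp_div_Suc_0_wedge[OF ext_part_finite[OF x(1)] x(2)], of "g - k" k])
      (use kg in \<open>auto simp: primitive_rel_def primitive_iff\<close>)
qed

text \<open>Surjectivity: now the image of z is divided by \<omega>^[d-r], where the degree bound
  holds with slack r.\<close>

lemma primitive_rel_ex':
  assumes "z \<in> lefschetz g 0 k"
  shows "\<exists>x\<in>lefschetz g (int r) (k + 2 * r). primitive_rel x z"
proof -
  have z: "z \<in> ext_part (2 * g) (int k)" "symp_div g (Suc (g - k)) \<and>\<and> z = 0"
    using assms by (auto simp: primitive_iff)
  have y: "symp_div g (g - k) \<and>\<and> z \<in> ext_part (2 * g) (int k + 2 * int (g - k))"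
    by (rule symp_div_wedge_in_ext_part[OF z(1)]) simp
  obtain x where "x \<in> ext_part (2 * g) (int (k + 2 * r))"
    "symp_div g (g - k - r) \<and>\<and> x = symp_div g (g - k) \<and>\<and> z" "symp_div g (Suc (g - k - r)) \<and>\<and> x = 0"
    by (rule symp_div_wedge_kernel[OF y symp_div_Suc_0_wedge[OF ext_part_finite[OF z(1)] z(2)],
          of "g - k - r" "k + 2 * r"]) (use kg rg in auto)
  then have "x \<in> lefschetz g (int r) (k + 2 * r)" "primitive_rel x z"
    unfolding primitive_rel_def lefschetz_r_iff using assms by simp_all
  then show ?thesis by blast
qed

lemma primitive_rel_unique:
  assumes "primitive_rel x z" "primitive_rel x z'"
  shows "z = z'"
proof -
  have "z - z' = 0"
    by (rule symp_div_wedge_inj[of _ g "int k" "g - k"])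
      (use assms kg in \<open>auto simp: primitive_rel_def primitive_iff ext_part_diff wedge_diff_right\<close>)
  then show ?thesis by simp
qed

definition primitive_part :: "ext \<Rightarrow> ext" where
  "primitive_part x = (THE z. primitive_rel x z)"

lemma primitive_part_eqI: "primitive_rel x z \<Longrightarrow> primitive_part x = z"
  unfolding primitive_part_def using primitive_rel_unique by blast

lemma primitive_part_rel:
  "x \<in> lefschetz g (int r) (k + 2 * r) \<Longrightarrow> primitive_rel x (primitive_part x)"
  using primitive_rel_ex primitive_part_eqI by metis

lemma primitive_rel_add:
  "primitive_rel x z \<Longrightarrow> primitive_rel x' z' \<Longrightarrow> primitive_rel (x + x') (z + z')"
  by (auto simp: primitive_rel_def primitive_iff ext_part_add wedge_add_right)

lemma primitive_rel_ext_map: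
  assumes "A \<in> carrier (Sp g)" "x \<in> lefschetz g (int r) (k + 2 * r)" "primitive_rel x z"
  shows "primitive_rel (ext_map A x) (ext_map A z)"
proof -
  have fin: "ext_finite x" "ext_finite z"
    using assms(2,3) ext_part_finite by (auto simp: primitive_rel_def lefschetz_iff)
  then show ?thesis
    using assms(1,3) ext_map_in_lefschetz[OF assms(1)]
      Sp_ext_map_symp_div_wedge[OF assms(1) fin(1), symmetric]
      Sp_ext_map_symp_div_wedge[OF assms(1) fin(2), symmetric]
    by (auto simp: primitive_rel_def)
qed

lemma group_hom_primitive_part:
  "group_hom (lefschetz_group g (int r) (k + 2 * r)) (primitive_group g k) primitive_part"
proof (intro group_hom.intro group_hom_axioms.intro homI)
  fix x y
  assume x: "x \<in> carrier (lefschetz_group g (int r) (k + 2 * r))"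
    and y: "y \<in> carrier (lefschetz_group g (int r) (k + 2 * r))"
  show "primitive_part x \<in> carrier (primitive_group g k)"
    using primitive_part_rel[of x] x by (simp add: primitive_group_def primitive_rel_def)
  show "primitive_part (x \<otimes>\<^bsub>lefschetz_group g (int r) (k + 2 * r)\<^esub> y) =
      primitive_part x \<otimes>\<^bsub>primitive_group g k\<^esub> primitive_part y"
    using x y by (simp add: primitive_group_def primitive_part_eqI primitive_rel_add primitive_part_rel)
qed (auto simp: primitive_group_def comm_group.axioms(2)[OF comm_group_lefschetz_group])

text \<open>Being related to 0 means being killed by \<omega>^[d-r], the condition that defines
  F_(r-1) in this degree.\<close>

lemma kernel_primitive_part:
  "kernel (lefschetz_group g (int r) (k + 2 * r)) (primitive_group g k) primitive_part =
    lefschetz g (int r - 1) (k + 2 * r)"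
proof (intro Set.set_eqI iffI)
  fix x assume "x \<in> kernel (lefschetz_group g (int r) (k + 2 * r)) (primitive_group g k) primitive_part"
  then have x: "x \<in> lefschetz g (int r) (k + 2 * r)" "primitive_part x = 0"
    by (auto simp: kernel_def primitive_group_def)
  have "primitive_rel x 0" using primitive_part_rel[OF x(1)] x(2) by simp
  then show "x \<in> lefschetz g (int r - 1) (k + 2 * r)"
    using x(1) by (simp add: primitive_rel_def lefschetz_r_iff lefschetz_r_pred_iff)
next
  fix x assume x: "x \<in> lefschetz g (int r - 1) (k + 2 * r)"
  then have "primitive_rel x 0" by (simp add: primitive_rel_def primitive_iff lefschetz_r_pred_iff)
  then show "x \<in> kernel (lefschetz_group g (int r) (k + 2 * r)) (primitive_group g k) primitive_part"
    using x lefschetz_step_subset[of g "int r" "k + 2 * r"] primitive_part_eqI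
    by (auto simp: kernel_def primitive_group_def)
qed

lemma module_isomorphic_lefschetz_gr:
  "module_isomorphic (Sp g) (lefschetz_gr g (int r) (k + 2 * r)) (\<lambda>A X. ext_map A ` X)
     (primitive_group g k) ext_map"
proof -
  let ?L = "lefschetz_group g (int r) (k + 2 * r)" and ?K = "lefschetz g (int r - 1) (k + 2 * r)"
  let ?P = "primitive_group g k" and ?h = "\<lambda>X. the_elem (primitive_part ` X)"
  interpret h: group_hom ?L ?P primitive_part by (rule group_hom_primitive_part)
  have "primitive_part ` carrier ?L = carrier ?P"
  proof
    show "primitive_part ` carrier ?L \<subseteq> carrier ?P" using h.hom_closed by blast
    show "carrier ?P \<subseteq> primitive_part ` carrier ?L"
      using primitive_rel_ex' primitive_part_eqI by (fastforce simp: primitive_group_def)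
  qed
  then have iso: "?h \<in> iso (lefschetz_gr g (int r) (k + 2 * r)) ?P"
    using h.FactGroup_iso_set by (simp add: lefschetz_gr_def kernel_primitive_part)
  \<comment> \<open>The map from the first isomorphism theorem is constant on each coset, so it can
    be computed on a representative; equivariance is then that of
    \<open>primitive_part\<close>.\<close>
  have coset: "?h (?K #>\<^bsub>?L\<^esub> x) = primitive_part x" if x: "x \<in> lefschetz g (int r) (k + 2 * r)" for x
  proof -
    have K: "primitive_part y = 0 \<and> y \<in> carrier ?L" if "y \<in> ?K" for y
      using that unfolding kernel_primitive_part[symmetric] kernel_def by (simp add: primitive_group_def)
    have "primitive_part (y + x) = primitive_part x" if "y \<in> ?K" for y
      using h.hom_mult[of y x] K[OF that] x by (simp add: primitive_group_def)
    moreover have "0 \<in> ?K" by (simp add: lefschetz_iff)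
    ultimately have "primitive_part ` (?K #>\<^bsub>?L\<^esub> x) = {primitive_part x}"
      by (auto simp: r_coset_def)
    then show ?thesis by simp
  qed
  have "?h (ext_map A ` X) = ext_map A (?h X)"
    if A: "A \<in> carrier (Sp g)" and X: "X \<in> carrier (lefschetz_gr g (int r) (k + 2 * r))" for A X
  proof -
    obtain x where x: "x \<in> lefschetz g (int r) (k + 2 * r)" "X = ?K #>\<^bsub>?L\<^esub> x"
      using lefschetz_gr_carrierE[OF X] .
    have "primitive_part (ext_map A x) = ext_map A (primitive_part x)"
      by (intro primitive_part_eqI primitive_rel_ext_map A x primitive_part_rel)
    then show ?thesis
      unfolding x(2) ext_map_image_coset[OF A] coset[OF x(1)] coset[OF ext_map_in_lefschetz[OF A x(1)]] .
  qed
  then show ?thesis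
    unfolding module_isomorphic_def
    by (intro conjI bexI[OF _ iso] ballI group_module_lefschetz_gr
        group_module_lefschetz[of g 0 k, folded primitive_group_def])
qed

end

theorem theorem1p1:
  fixes g k r :: nat
  assumes "k \<le> g" and "r \<le> g - k"
  shows "is_free_abelian (lefschetz_gr g (int r) (k + 2 * r)) \<and>
         module_isomorphic (Sp g)
           (lefschetz_gr g (int r) (k + 2 * r)) (\<lambda>A X. ext_map A ` X)
           (primitive_group g k) ext_map"
proof
  show iso: "module_isomorphic (Sp g) (lefschetz_gr g (int r) (k + 2 * r)) (\<lambda>A X. ext_map A ` X)
      (primitive_group g k) ext_map"
    by (rule module_isomorphic_lefschetz_gr[OF assms])
  then have "lefschetz_gr g (int r) (k + 2 * r) \<cong> primitive_group g k"
    by (auto simp: module_isomorphic_def is_iso_def)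
  then show "is_free_abelian (lefschetz_gr g (int r) (k + 2 * r))"
    \<comment> \<open>The elements of the subquotient are sets, so the basis index set must be moved
      from \<open>ext\<close> to \<open>ext set\<close>; the singleton map serves only as an
      injection of types.\<close>
    by (rule is_free_abelian_iso[where f = "\<lambda>x. {x}"])
      (auto simp: primitive_group_def is_free_abelian_lefschetz_group)
qed

end
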